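(* Let $\delta\in[0,\tfrac12)$ and let $h(\delta)=-\delta\log_2\delta-(1-\delta)\log_2(1-\delta)$ (with $h(0)=0$). Let $(r_m)_{m\ge1}$ be integers with $0\le r_m\le m$ and \[\limsup_{m\to\infty}\frac{\binom{m}{\le r_m}}{2^m}<1-h(\delta),\qquad \binom{m}{\le r}:=\sum_{i=0}^{r}\binom{m}{i}.\] Then the bit-error probability of the Reed–Muller code $RM(m,r_m)$ on the binary symmetric channel with crossover probability $\delta$ satisfies $P_{\mathrm{bit}}=2^{-\Omega(\sqrt m)}$, i.e. there exist $c>0$ and $m_0$ such that $P_{\mathrm{bit}}\le 2^{-c\sqrt m}$ for all $m\ge m_0$.
   Context: For $m\ge1$ let $n=2^m$. The Reed–Muller code $RM(m,r)\subseteq\mathbb{F}_2^{n}$ is the set of evaluation vectors $(P(x))_{x\in\mathbb{F}_2^m}$ of all polynomials $P\in\mathbb{F}_2[x_1,\dots,x_m]$ of degree at most $r$. Transmission model: $X$ is a uniformly random codeword of $RM(m,r)$ (equivalently, the evaluation vector of a polynomial $\sum_{|A|\le r}u_A\prod_{i\in A}x_i$ with i.i.d. uniform coefficients $u_A\in\mathbb{F}_2$), $Z\in\mathbb{F}_2^n$ has i.i.d. Bernoulli$(\delta)$ coordinates independent of $X$, and $Y=X+Z$ is received. For a coordinate $x\in\mathbb{F}_2^m$, $\widehat{X_x}(Y)$ denotes the most likely value of $X_x$ given $Y$ (maximum a posteriori bitwise decision, ties broken arbitrarily), and $P_{\mathrm{bit}}:=\max_{x\in\mathbb{F}_2^m}\mathbb{P}(\widehat{X_x}(Y)\ne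 X_x)$. *)

theory Defs
  imports Complex_Main "HOL-Library.Extended_Real"
begin

text \<open>Points of F_2^m are encoded as subsets of {0..<m} (the set of coordinates equal to 1).
  A vector in F_2^n (n = 2^m), indexed by points, is encoded as the set of points where it is 1.\<close>

definition rm_points :: "nat \<Rightarrow> nat set set" where
  "rm_points m = Pow {..<m}"

definition rm_monos :: "nat \<Rightarrow> nat \<Rightarrow> nat set set" where
  "rm_monos m r = {A \<in> Pow {..<m}. card A \<le> r}"

text \<open>Coefficient vectors (u_A)_{|A| \<le> r}, as the set of monomials with coefficient 1.\<close>
definition rm_coeffs :: "nat \<Rightarrow> nat \<Rightarrow> nat set set set" where
  "rm_coeffs m r = Pow (rm_monos m r)"

text \<open>Value at point x of the polynomial sum_{A in U} prod_{i in A} x_i.\<close>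
definition rm_eval :: "nat set set \<Rightarrow> nat set \<Rightarrow> bool" where
  "rm_eval U x = odd (card {A \<in> U. A \<subseteq> x})"

text \<open>Received word Y = X + Z, where the noise Z is given by its support z.\<close>
definition rm_received :: "nat \<Rightarrow> nat set set \<Rightarrow> nat set set \<Rightarrow> nat set set" where
  "rm_received m U z = {p \<in> rm_points m. rm_eval U p \<noteq> (p \<in> z)}"

definition rm_weight :: "nat \<Rightarrow> nat \<Rightarrow> real \<Rightarrow> nat set set \<Rightarrow> nat set set \<Rightarrow> real" where
  "rm_weight m r \<delta> U z =
     (1 / real (card (rm_coeffs m r))) * \<delta> ^ card z * (1 - \<delta>) ^ (2 ^ m - card z)"

definition rm_joint :: "nat \<Rightarrow> nat \<Rightarrow> real \<Rightarrow> nat set \<Rightarrow> bool \<Rightarrow> nat set set \<Rightarrow> real" where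
  "rm_joint m r \<delta> x b y =
     (\<Sum>U\<in>rm_coeffs m r. \<Sum>z\<in>Pow (rm_points m).
        if rm_eval U x = b \<and> rm_received m U z = y then rm_weight m r \<delta> U z else 0)"

definition is_bit_MAP :: "nat \<Rightarrow> nat \<Rightarrow> real \<Rightarrow> nat set \<Rightarrow> (nat set set \<Rightarrow> bool) \<Rightarrow> bool" where
  "is_bit_MAP m r \<delta> x d \<longleftrightarrow>
     (\<forall>y \<in> Pow (rm_points m). rm_joint m r \<delta> x (d y) y \<ge> rm_joint m r \<delta> x (\<not> d y) y)"

definition bit_error :: "nat \<Rightarrow> nat \<Rightarrow> real \<Rightarrow> nat set \<Rightarrow> (nat set set \<Rightarrow> bool) \<Rightarrow> real" where
  "bit_error m r \<delta> x d =
     (\<Sum>U\<in>rm_coeffs m r. \<Sum>z\<in>Pow (rm_points m).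
        if d (rm_received m U z) \<noteq> rm_eval U x then rm_weight m r \<delta> U z else 0)"

definition bin_entropy :: "real \<Rightarrow> real" where
  "bin_entropy d = (if d = 0 then 0 else - d * log 2 d - (1 - d) * log 2 (1 - d))"

definition binom_le :: "nat \<Rightarrow> nat \<Rightarrow> nat" where
  "binom_le m r = (\<Sum>i\<le>r. m choose i)"

end

theory Submission
  imports Defs
begin

text \<open>If the rate is at most \<open>1 - h(\<delta>) - \<epsilon>\<close>, the received word is far from uniform in entropy, so the chain
  rule produces a coordinate \<open>i\<close> and a function \<open>g\<close> of the other received symbols whose correlation with
  the sent bit at \<open>i\<close> is bounded below. This applies to \<open>RM(m', r)\<close> with \<open>m' = m - a \<surd>m\<close> as well, since
  lowering \<open>m\<close> by one raises the rate by only \<open>O(1/\<surd>m)\<close>.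
  The bit at a point \<open>x\<close> of the long code is then predicted by the average of \<open>g\<close> over all the
  \<open>m'\<close>-dimensional affine graphs through \<open>x\<close>, on each of which the long code restricts to
  \<open>RM(m', r)\<close>. A given point other than the base point is common to two random graphs with
  probability \<open>2 ^ (m' - m)\<close>; expanding \<open>g\<close> in the characters of the noise, this probability bounds the
  variance of the average, and Chebyshev's inequality bounds the error probability.\<close>

section \<open>Characters of the noise\<close>

text \<open>Law of i.i.d. noise on \<open>A\<close>. The product form makes sums over
  \<open>Pow A\<close> factor over the points; \<open>bern_eq\<close> recovers the powers of the
  transmission model.\<close>

definition bern :: "real \<Rightarrow> 'a set \<Rightarrow> 'a set \<Rightarrow> real" where
  "bern \<delta> A z = (\<Prod>a\<in>A. if a \<in> z then \<delta> else 1 - \<delta>)"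

text \<open>Biased Fourier characters: each factor is a centred error indicator, so it has mean 0
  and variance \<open>\<delta> * (1 - \<delta>)\<close> under \<open>bern\<close>.\<close>

definition chi :: "real \<Rightarrow> 'a set \<Rightarrow> 'a set \<Rightarrow> real" where
  "chi \<delta> S z = (\<Prod>a\<in>S. of_bool (a \<in> z) - \<delta>)"

lemma sum_Pow_insert:
  assumes "finite A" "u \<notin> A"
  shows "(\<Sum>z\<in>Pow (insert u A). f z) = (\<Sum>z\<in>Pow A. f z + f (insert u z))"
proof -
  have "inj_on (insert u) (Pow A)"
    using assms(2) by (auto simp: inj_on_def)
  moreover have "Pow A \<inter> insert u ` Pow A = {}"
    using assms(2) by auto
  ultimately show ?thesis
    using assms(1) by (simp add: Pow_insert sum.union_disjoint sum.reindex sum.distrib)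
qed

text \<open>The distributive law, with \<open>z\<close> recording which of the two summands is
  chosen at each point. This is how independence of the noise bits enters.\<close>

lemma sum_Pow_prod:
  fixes f :: "'a \<Rightarrow> bool \<Rightarrow> 'b::comm_semiring_1"
  assumes "finite A"
  shows "(\<Sum>z\<in>Pow A. \<Prod>a\<in>A. f a (a \<in> z)) = (\<Prod>a\<in>A. f a True + f a False)"
  using assms
proof (induction A)
  case (insert u A)
  have *: "(\<Prod>a\<in>A. f a (a = u \<or> a \<in> z)) = (\<Prod>a\<in>A. f a (a \<in> z))" for z
    by (rule prod.cong[OF refl], rule arg_cong[of _ _ "f _"]) (use insert.hyps in auto)
  have u: "u \<notin> z" if "z \<in> Pow A" for z
    using that insert.hyps by auto
  have "(\<Sum>z\<in>Pow (insert u A). \<Prod>a\<in>insert u A. f a (a \<in> z))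
      = (\<Sum>z\<in>Pow A. (f u True + f u False) * (\<Prod>a\<in>A. f a (a \<in> z)))"
    unfolding sum_Pow_insert[OF insert.hyps]
    by (rule sum.cong[OF refl]) (use insert.hyps u in \<open>simp add: * algebra_simps\<close>)
  also have "\<dots> = (f u True + f u False) * (\<Prod>a\<in>A. f a True + f a False)"
    by (simp flip: sum_distrib_left add: insert.IH)
  finally show ?case using insert.hyps by simp
qed simp

lemma bern_nonneg: "0 \<le> \<delta> \<Longrightarrow> \<delta> \<le> 1 \<Longrightarrow> 0 \<le> bern \<delta> A z"
  by (auto simp: bern_def intro!: prod_nonneg)

lemma bern_insert:
  assumes "finite A" "u \<notin> A" "z \<subseteq> A"
  shows "bern \<delta> (insert u A) z = (1 - \<delta>) * bern \<delta> A z"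
    and "bern \<delta> (insert u A) (insert u z) = \<delta> * bern \<delta> A z"
proof -
  have "(\<Prod>a\<in>A. if a = u \<or> a \<in> z then \<delta> else 1 - \<delta>) = (\<Prod>a\<in>A. if a \<in> z then \<delta> else 1 - \<delta>)"
    using assms by (intro prod.cong) auto
  thus "bern \<delta> (insert u A) z = (1 - \<delta>) * bern \<delta> A z"
    and "bern \<delta> (insert u A) (insert u z) = \<delta> * bern \<delta> A z"
    using assms by (auto simp: bern_def)
qed

lemma bern_eq:
  assumes "finite A" "z \<subseteq> A"
  shows "bern \<delta> A z = \<delta> ^ card z * (1 - \<delta>) ^ (card A - card z)"
proof -
  have "A \<inter> z = z" "A \<inter> - z = A - z" using assms by auto
  thus ?thesis
    using assms finite_subset[OF assms(2,1)]
    by (simp add: bern_def prod.If_cases card_Diff_subset)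
qed

lemma sum_bern: "finite A \<Longrightarrow> (\<Sum>z\<in>Pow A. bern \<delta> A z) = 1"
  unfolding bern_def using sum_Pow_prod[of A "\<lambda>a b. if b then \<delta> else 1 - \<delta>"] by simp

text \<open>The expectation factors over the points. A point in exactly one of \<open>S\<close> and
  \<open>T\<close> contributes the mean of a centred variable, which is 0; a point in both
  contributes its variance, and any other point contributes 1.\<close>

lemma chi_orthogonal:
  assumes "finite P" "S \<subseteq> P" "T \<subseteq> P"
  shows "(\<Sum>z\<in>Pow P. bern \<delta> P z * (chi \<delta> S z * chi \<delta> T z))
       = (if S = T then (\<delta> * (1 - \<delta>)) ^ card S else 0)"
proof -
  define f :: "'a \<Rightarrow> bool \<Rightarrow> real" where "f a b = (if b then \<delta> else 1 - \<delta>)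
    * ((if a \<in> S then of_bool b - \<delta> else 1) * (if a \<in> T then of_bool b - \<delta> else 1))" for a b
  have chi: "chi \<delta> Q z = (\<Prod>a\<in>P. if a \<in> Q then of_bool (a \<in> z) - \<delta> else 1)" if "Q \<subseteq> P" for Q z
    using that assms(1) by (auto simp: chi_def prod.If_cases Int_absorb1 intro!: prod.cong)
  have "bern \<delta> P z * (chi \<delta> S z * chi \<delta> T z) = (\<Prod>a\<in>P. f a (a \<in> z))" for z
    unfolding bern_def chi[OF assms(2)] chi[OF assms(3)] f_def by (simp add: prod.distrib)
  hence "(\<Sum>z\<in>Pow P. bern \<delta> P z * (chi \<delta> S z * chi \<delta> T z)) = (\<Prod>a\<in>P. f a True + f a False)"
    using sum_Pow_prod[OF assms(1), of f] by simp
  also have "\<dots> = (\<Prod>a\<in>P. if a \<in> S \<and> a \<in> T then \<delta> * (1 - \<delta>) else if a \<in> S \<or> a \<in> T then 0 else 1)"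
    by (intro prod.cong) (auto simp: f_def algebra_simps)
  also have "\<dots> = (if S = T then (\<delta> * (1 - \<delta>)) ^ card S else 0)"
  proof (cases "S = T")
    case True
    have "(\<Prod>a\<in>P. if a \<in> S \<and> a \<in> T then \<delta> * (1 - \<delta>) else if a \<in> S \<or> a \<in> T then 0 else 1)
        = (\<Prod>a\<in>P. if a \<in> S then \<delta> * (1 - \<delta>) else 1)"
      using True by (intro prod.cong) auto
    also have "\<dots> = (\<delta> * (1 - \<delta>)) ^ card S"
      using assms by (simp add: prod.If_cases Int_absorb1)
    finally show ?thesis using True by simp
  next
    case False
    then obtain a where "a \<in> P" "a \<in> S \<longleftrightarrow> a \<notin> T" using assms by auto
    thus ?thesis using False assms(1) by (auto intro!: bexI[of _ a])
  qed
  finally show ?thesis .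
qed

text \<open>Unlike the orthonormal basis, the characters \<open>chi \<delta> S\<close> are not divided by their standard
  deviation, so that the expansion is still available for \<open>\<delta> = 0\<close>.\<close>

lemma chi_expansion:
  fixes g :: "'a set \<Rightarrow> real"
  assumes "finite A"
  shows "\<exists>h. \<forall>z\<in>Pow A. g z = (\<Sum>S\<in>Pow A. h S * chi \<delta> S z)"
  using assms
proof (induction A arbitrary: g)
  case empty
  show ?case by (rule exI[of _ g]) (simp add: chi_def)
next
  case (insert u A)
  \<comment> \<open>In the coordinate \<open>u\<close>, \<open>g\<close> is its conditional mean
    (expanded by \<open>h0\<close>) plus the centred indicator of \<open>u\<close> times its
    discrete derivative (expanded by \<open>h1\<close>).\<close>
  obtain h0 where h0: "(1 - \<delta>) * g z + \<delta> * g (insert u z) = (\<Sum>S\<in>Pow A. h0 S * chi \<delta> S z)"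
    if "z \<in> Pow A" for z
    using insert.IH[of "\<lambda>z. (1 - \<delta>) * g z + \<delta> * g (insert u z)"] by blast
  obtain h1 where h1: "g (insert u z) - g z = (\<Sum>S\<in>Pow A. h1 S * chi \<delta> S z)"
    if "z \<in> Pow A" for z
    using insert.IH[of "\<lambda>z. g (insert u z) - g z"] by blast
  define h where "h S = (if u \<in> S then h1 (S - {u}) else h0 S)" for S
  have "g z = (\<Sum>S\<in>Pow (insert u A). h S * chi \<delta> S z)" if "z \<in> Pow (insert u A)" for z
  proof -
    let ?z = "z - {u}"
    have z: "?z \<in> Pow A" using that by auto
    have chi1: "chi \<delta> S z = chi \<delta> S ?z" if "S \<in> Pow A" for S
      unfolding chi_def using that insert.hyps by (intro prod.cong) auto
    have chi2: "chi \<delta> (insert u S) z = (of_bool (u \<in> z) - \<delta>) * chi \<delta> S ?z" if "S \<in> Pow A" for S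
    proof -
      have "u \<notin> S" "finite S" using that insert.hyps finite_subset[of S A] by auto
      thus ?thesis using chi1[OF that] by (simp add: chi_def)
    qed
    have hS: "h S = h0 S" "h (insert u S) = h1 S" if "S \<in> Pow A" for S
    proof -
      have "u \<notin> S" using that insert.hyps by auto
      thus "h S = h0 S" "h (insert u S) = h1 S" by (simp_all add: h_def)
    qed
    have "(\<Sum>S\<in>Pow (insert u A). h S * chi \<delta> S z)
        = (\<Sum>S\<in>Pow A. h0 S * chi \<delta> S ?z + (of_bool (u \<in> z) - \<delta>) * (h1 S * chi \<delta> S ?z))"
      unfolding sum_Pow_insert[OF insert.hyps]
      by (rule sum.cong) (simp_all add: hS chi1 chi2)
    also have "\<dots> = (1 - \<delta>) * g ?z + \<delta> * g (insert u ?z)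
        + (of_bool (u \<in> z) - \<delta>) * (g (insert u ?z) - g ?z)"
      by (simp add: sum.distrib flip: sum_distrib_left h0[OF z] h1[OF z])
    also have "\<dots> = g z"
      by (cases "u \<in> z") (simp_all add: insert_absorb algebra_simps)
    finally show ?thesis by simp
  qed
  thus ?case by blast
qed

text \<open>The points of \<open>A\<close> are placed in \<open>P\<close> by each of the maps \<open>e b\<close>. Two of the averaged copies of \<open>g\<close>
  are correlated only through the nonempty \<open>S\<close> on which their maps agree, which is rare by \<open>coll\<close>.\<close>

lemma average_variance:
  fixes e :: "'b \<Rightarrow> 'a \<Rightarrow> 'p" and g :: "'a set \<Rightarrow> real"
  assumes fin: "finite A" "finite P" "finite F" "F \<noteq> {}" and \<delta>: "0 \<le> \<delta>" "\<delta> \<le> 1"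
    and e_in: "\<And>b a. b \<in> F \<Longrightarrow> a \<in> A \<Longrightarrow> e b a \<in> P"
    and e_eq: "\<And>b b' a a'. b \<in> F \<Longrightarrow> b' \<in> F \<Longrightarrow> a \<in> A \<Longrightarrow> a' \<in> A \<Longrightarrow> e b a = e b' a' \<Longrightarrow> a = a'"
    and coll: "\<And>a. a \<in> A \<Longrightarrow> real (card {(b, b') \<in> F \<times> F. e b a = e b' a}) \<le> p * (real (card F))\<^sup>2"
    and p: "0 \<le> p"
    and bound: "\<And>z. z \<in> Pow A \<Longrightarrow> \<bar>g z\<bar> \<le> 1"
  shows "(\<Sum>z\<in>Pow P. bern \<delta> P z * ((\<Sum>b\<in>F. g {a \<in> A. e b a \<in> z}) / real (card F)
           - (\<Sum>z\<in>Pow A. bern \<delta> A z * g z))\<^sup>2) \<le> p"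
proof -
  obtain h where h: "\<And>z. z \<in> Pow A \<Longrightarrow> g z = (\<Sum>S\<in>Pow A. h S * chi \<delta> S z)"
    using chi_expansion[OF fin(1), of g \<delta>] by blast
  define n where "n = real (card F)"
  have n: "n > 0" using fin by (auto simp: n_def card_gt_0_iff)
  define q where "q = \<delta> * (1 - \<delta>)"
  have q: "0 \<le> q" using \<delta> by (simp add: q_def)
  define W where "W = Pow A - {{}}"
  have finW: "finite W" using fin by (simp add: W_def)
  have chi_empty: "chi \<delta> {} z = 1" for z :: "'x set" by (simp add: chi_def)

  have mean: "(\<Sum>z\<in>Pow A. bern \<delta> A z * g z) = h {}"
  proof -
    have "(\<Sum>z\<in>Pow A. bern \<delta> A z * g z)
        = (\<Sum>z\<in>Pow A. \<Sum>S\<in>Pow A. h S * (bern \<delta> A z * (chi \<delta> S z * chi \<delta> {} z)))"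
      by (rule sum.cong) (simp_all add: h sum_distrib_left chi_empty algebra_simps)
    also have "\<dots> = (\<Sum>S\<in>Pow A. h S * (\<Sum>z\<in>Pow A. bern \<delta> A z * (chi \<delta> S z * chi \<delta> {} z)))"
      by (subst sum.swap) (simp add: sum_distrib_left)
    also have "\<dots> = (\<Sum>S\<in>Pow A. if S = {} then h {} else 0)"
      by (intro sum.cong refl) (simp add: chi_orthogonal[OF fin(1)])
    also have "\<dots> = h {}" using fin by simp
    finally show ?thesis .
  qed

  \<comment> \<open>Parseval: the left-hand side is the second moment of \<open>g\<close>.\<close>
  have square: "(\<Sum>S\<in>Pow A. (h S)\<^sup>2 * q ^ card S) \<le> 1"
  proof -
    have "(\<Sum>S\<in>Pow A. (h S)\<^sup>2 * q ^ card S)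
        = (\<Sum>S\<in>Pow A. \<Sum>T\<in>Pow A. if S = T then (h S)\<^sup>2 * q ^ card S else 0)"
      using fin by (intro sum.cong refl) simp
    also have "\<dots> = (\<Sum>S\<in>Pow A. \<Sum>T\<in>Pow A. h S * h T *
        (\<Sum>z\<in>Pow A. bern \<delta> A z * (chi \<delta> S z * chi \<delta> T z)))"
      by (intro sum.cong refl) (auto simp: chi_orthogonal[OF fin(1)] q_def power2_eq_square)
    also have "\<dots> = (\<Sum>S\<in>Pow A. \<Sum>T\<in>Pow A. \<Sum>z\<in>Pow A. bern \<delta> A z * ((h S * chi \<delta> S z) * (h T * chi \<delta> T z)))"
      by (simp add: sum_distrib_left algebra_simps)
    also have "\<dots> = (\<Sum>z\<in>Pow A. \<Sum>S\<in>Pow A. \<Sum>T\<in>Pow A. bern \<delta> A z * ((h S * chi \<delta> S z) * (h T * chi \<delta> T z)))"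
      by (subst sum.swap, subst (2) sum.swap) (rule refl)
    also have "\<dots> = (\<Sum>z\<in>Pow A. bern \<delta> A z * (g z * g z))"
      by (rule sum.cong[OF refl]) (simp only: h sum_product, simp only: sum_distrib_left)
    also have "\<dots> \<le> (\<Sum>z\<in>Pow A. bern \<delta> A z)"
    proof (rule sum_mono)
      fix z assume "z \<in> Pow A"
      hence "g z * g z \<le> 1" using bound[of z] by (simp add: abs_square_le_1 flip: power2_eq_square)
      thus "bern \<delta> A z * (g z * g z) \<le> bern \<delta> A z"
        using mult_left_mono[of "g z * g z" 1 "bern \<delta> A z"] bern_nonneg[OF \<delta>, of A z] by simp
    qed
    also have "\<dots> = 1" using sum_bern[OF fin(1)] .
    finally show ?thesis .
  qed

  \<comment> \<open>By \<open>e_eq\<close> a point of \<open>P\<close> has the same preimage under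
    every map, so equal images force equal sets and pointwise agreement of the two maps.\<close>
  have image_eq: "S = T \<and> (\<forall>a\<in>S. e b a = e b' a)"
    if "b \<in> F" "b' \<in> F" "S \<in> W" "T \<in> W" "e b ` S = e b' ` T" for b b' S T
  proof -
    have S: "a \<in> A" if "a \<in> S \<or> a \<in> T" for a using that \<open>S \<in> W\<close> \<open>T \<in> W\<close> by (auto simp: W_def)
    have 1: "a \<in> T \<and> e b a = e b' a" if "a \<in> S" for a
    proof -
      have "e b a \<in> e b' ` T" using \<open>e b ` S = e b' ` T\<close> that by blast
      then obtain a' where "a' \<in> T" "e b a = e b' a'" by blast
      thus ?thesis using e_eq[of b b' a a'] S that \<open>b \<in> F\<close> \<open>b' \<in> F\<close> by auto
    qed
    have 2: "a \<in> S" if "a \<in> T" for a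
    proof -
      have "e b' a \<in> e b ` S" using \<open>e b ` S = e b' ` T\<close> that by blast
      then obtain a' where "a' \<in> S" "e b' a = e b a'" by blast
      thus ?thesis using e_eq[of b' b a a'] S that \<open>b \<in> F\<close> \<open>b' \<in> F\<close> by auto
    qed
    show ?thesis using 1 2 by blast
  qed
  have chi_image: "chi \<delta> S {a \<in> A. e b a \<in> z} = chi \<delta> (e b ` S) z"
    if "b \<in> F" "S \<in> Pow A" for b S z
  proof -
    have "inj_on (e b) S" using that by (auto intro!: inj_onI e_eq[of b b])
    moreover have "a \<in> A" if "a \<in> S" for a using that \<open>S \<in> Pow A\<close> by auto
    ultimately show ?thesis by (simp add: chi_def prod.reindex)
  qed

  \<comment> \<open>The constant coefficient \<open>h {}\<close> is the mean, so only nonempty sets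
    enter the deviation from it.\<close>
  define D where "D z = (\<Sum>b\<in>F. \<Sum>S\<in>W. h S * chi \<delta> (e b ` S) z)" for z
  have D: "(\<Sum>b\<in>F. g {a \<in> A. e b a \<in> z}) / n - h {} = D z / n" for z
  proof -
    have "g {a \<in> A. e b a \<in> z} = h {} + (\<Sum>S\<in>W. h S * chi \<delta> (e b ` S) z)" if "b \<in> F" for b
    proof -
      have "g {a \<in> A. e b a \<in> z} = (\<Sum>S\<in>Pow A. h S * chi \<delta> (e b ` S) z)"
        using h[of "{a \<in> A. e b a \<in> z}"] that by (simp add: chi_image)
      also have "\<dots> = h {} + (\<Sum>S\<in>W. h S * chi \<delta> (e b ` S) z)"
        unfolding W_def using fin by (subst sum.remove[of _ "{}"]) (auto simp: chi_empty)
      finally show ?thesis .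
    qed
    hence "(\<Sum>b\<in>F. g {a \<in> A. e b a \<in> z}) = n * h {} + D z"
      by (simp add: D_def sum.distrib n_def)
    thus ?thesis using n by (simp add: field_simps)
  qed

  have pairs: "(\<Sum>i\<in>F\<times>W. f i) = (\<Sum>b\<in>F. \<Sum>S\<in>W. f (b, S))" for f :: "_ \<Rightarrow> real"
    by (simp add: sum.cartesian_product)
  have "(\<Sum>z\<in>Pow P. bern \<delta> P z * (D z)\<^sup>2)
      = (\<Sum>z\<in>Pow P. \<Sum>i\<in>F\<times>W. \<Sum>j\<in>F\<times>W. h (snd i) * h (snd j) *
          (bern \<delta> P z * (chi \<delta> (e (fst i) ` snd i) z * chi \<delta> (e (fst j) ` snd j) z)))"
  proof (rule sum.cong[OF refl])
    fix z
    have "D z = (\<Sum>i\<in>F\<times>W. h (snd i) * chi \<delta> (e (fst i) ` snd i) z)"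
      by (simp add: D_def sum.cartesian_product case_prod_unfold)
    thus "bern \<delta> P z * (D z)\<^sup>2 = (\<Sum>i\<in>F\<times>W. \<Sum>j\<in>F\<times>W. h (snd i) * h (snd j) *
          (bern \<delta> P z * (chi \<delta> (e (fst i) ` snd i) z * chi \<delta> (e (fst j) ` snd j) z)))"
      by (simp only: power2_eq_square sum_product, simp only: sum_distrib_left, simp only: mult_ac)
  qed
  also have "\<dots> = (\<Sum>i\<in>F\<times>W. \<Sum>j\<in>F\<times>W. h (snd i) * h (snd j) *
      (\<Sum>z\<in>Pow P. bern \<delta> P z * (chi \<delta> (e (fst i) ` snd i) z * chi \<delta> (e (fst j) ` snd j) z)))"
    unfolding sum_distrib_left
    by (subst sum.swap, rule sum.cong[OF refl]) (rule sum.swap)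
  also have "\<dots> = (\<Sum>i\<in>F\<times>W. \<Sum>j\<in>F\<times>W.
      if snd j = snd i then (if e (fst i) ` snd i = e (fst j) ` snd i then (h (snd i))\<^sup>2 * q ^ card (snd i) else 0)
      else 0)"
  proof (intro sum.cong refl)
    fix i j assume i: "i \<in> F \<times> W" and j: "j \<in> F \<times> W"
    have sub: "e (fst i) ` snd i \<subseteq> P" "e (fst j) ` snd j \<subseteq> P"
      using i j e_in by (auto simp: W_def)
    have "inj_on (e (fst i)) (snd i)" using i by (auto intro!: inj_onI e_eq[of "fst i" "fst i"] simp: W_def)
    hence card: "card (e (fst i) ` snd i) = card (snd i)" by (rule card_image)
    have "snd j = snd i" if "e (fst i) ` snd i = e (fst j) ` snd j"
      using image_eq[of "fst i" "fst j" "snd i" "snd j"] that i j by auto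
    hence "e (fst i) ` snd i \<noteq> e (fst j) ` snd j" if "snd j \<noteq> snd i" using that by blast
    thus "h (snd i) * h (snd j) *
      (\<Sum>z\<in>Pow P. bern \<delta> P z * (chi \<delta> (e (fst i) ` snd i) z * chi \<delta> (e (fst j) ` snd j) z))
      = (if snd j = snd i then (if e (fst i) ` snd i = e (fst j) ` snd i then (h (snd i))\<^sup>2 * q ^ card (snd i) else 0)
      else 0)"
      unfolding chi_orthogonal[OF fin(2) sub] card
      by (cases "snd j = snd i") (simp_all add: q_def power2_eq_square)
  qed
  also have "\<dots> = (\<Sum>b\<in>F. \<Sum>S\<in>W. \<Sum>b'\<in>F. \<Sum>T\<in>W.
      if T = S then (if e b ` S = e b' ` S then (h S)\<^sup>2 * q ^ card S else 0) else 0)"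
    unfolding pairs fst_conv snd_conv ..
  also have "\<dots> = (\<Sum>b\<in>F. \<Sum>S\<in>W. \<Sum>b'\<in>F. if e b ` S = e b' ` S then (h S)\<^sup>2 * q ^ card S else 0)"
    using finW by (intro sum.cong refl) (simp cong: sum.cong)
  also have "\<dots> = (\<Sum>S\<in>W. \<Sum>b\<in>F. \<Sum>b'\<in>F. if e b ` S = e b' ` S then (h S)\<^sup>2 * q ^ card S else 0)"
    by (rule sum.swap)
  also have "\<dots> \<le> (\<Sum>S\<in>W. (h S)\<^sup>2 * q ^ card S * (p * n\<^sup>2))"
  proof (rule sum_mono)
    fix S assume S: "S \<in> W"
    \<comment> \<open>One point of \<open>S\<close> suffices: maps agreeing on all of
      \<open>S\<close> agree at \<open>a\<close>, and \<open>coll\<close> counts such pairs. This is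
      where nonemptiness of \<open>S\<close> is used.\<close>
    then obtain a where a: "a \<in> S" "a \<in> A" by (auto simp: W_def)
    have "(\<Sum>b\<in>F. \<Sum>b'\<in>F. if e b ` S = e b' ` S then (h S)\<^sup>2 * q ^ card S else 0)
        \<le> (\<Sum>b\<in>F. \<Sum>b'\<in>F. if e b a = e b' a then (h S)\<^sup>2 * q ^ card S else 0)"
    proof (intro sum_mono)
      fix b b' assume "b \<in> F" "b' \<in> F"
      hence "e b a = e b' a" if "e b ` S = e b' ` S"
        using image_eq[OF _ _ S S that] a(1) by blast
      moreover have "0 \<le> (h S)\<^sup>2 * q ^ card S" using q by simp
      ultimately show "(if e b ` S = e b' ` S then (h S)\<^sup>2 * q ^ card S else 0)
        \<le> (if e b a = e b' a then (h S)\<^sup>2 * q ^ card S else 0)"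
        by (smt (verit))
    qed
    also have "\<dots> = (\<Sum>(b, b')\<in>F \<times> F. if e b a = e b' a then (h S)\<^sup>2 * q ^ card S else 0)"
      by (simp add: sum.cartesian_product)
    also have "\<dots> = (\<Sum>i\<in>{(b, b') \<in> F \<times> F. e b a = e b' a}. (h S)\<^sup>2 * q ^ card S)"
      using fin by (intro sum.mono_neutral_cong_right) (auto split: if_splits)
    also have "\<dots> = (h S)\<^sup>2 * q ^ card S * real (card {(b, b') \<in> F \<times> F. e b a = e b' a})"
      by simp
    also have "\<dots> \<le> (h S)\<^sup>2 * q ^ card S * (p * n\<^sup>2)"
      using coll[OF a(2)] q by (intro mult_left_mono) (auto simp: n_def)
    finally show "(\<Sum>b\<in>F. \<Sum>b'\<in>F. if e b ` S = e b' ` S then (h S)\<^sup>2 * q ^ card S else 0)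
        \<le> (h S)\<^sup>2 * q ^ card S * (p * n\<^sup>2)" .
  qed
  also have "\<dots> = (\<Sum>S\<in>W. (h S)\<^sup>2 * q ^ card S) * (p * n\<^sup>2)"
    by (simp add: sum_distrib_right)
  also have "\<dots> \<le> 1 * (p * n\<^sup>2)"
  proof (rule mult_right_mono)
    have "(\<Sum>S\<in>W. (h S)\<^sup>2 * q ^ card S) \<le> (\<Sum>S\<in>Pow A. (h S)\<^sup>2 * q ^ card S)"
      using fin q by (intro sum_mono2) (auto simp: W_def)
    thus "(\<Sum>S\<in>W. (h S)\<^sup>2 * q ^ card S) \<le> 1" using square by simp
  qed (use p in simp)
  finally have "(\<Sum>z\<in>Pow P. bern \<delta> P z * (D z)\<^sup>2) / n\<^sup>2 \<le> p"
    using n by (simp add: field_simps)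
  moreover have "(\<Sum>z\<in>Pow P. bern \<delta> P z * (D z / n)\<^sup>2) = (\<Sum>z\<in>Pow P. bern \<delta> P z * (D z)\<^sup>2) / n\<^sup>2"
    by (simp add: power_divide sum_divide_distrib)
  ultimately show ?thesis
    unfolding mean by (simp add: D n_def[symmetric])
qed

section \<open>Weak prediction below capacity\<close>

text \<open>The squared bias of coordinate \<open>i\<close> given all the others, averaged over \<open>P\<close>.\<close>

definition influence :: "('a set \<Rightarrow> real) \<Rightarrow> 'a set \<Rightarrow> 'a \<Rightarrow> real" where
  "influence P A i = (\<Sum>y\<in>Pow (A - {i}). (P y - P (insert i y))\<^sup>2 / (P y + P (insert i y)))"

text \<open>Relative entropy to the uniform law on two points is at most the chi-squared distance.
  It follows from \<open>ln t \<le> t - 1\<close> at \<open>t = 2 * x / s\<close> for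
  \<open>x = p\<close> and \<open>x = q\<close>, where \<open>s = p + q\<close>.\<close>

lemma two_point_entropy:
  fixes p q :: real
  assumes "0 \<le> p" "0 \<le> q"
  shows "p * ln p + q * ln q \<le> (p + q) * ln (p + q) - (p + q) * ln 2 + (p - q)\<^sup>2 / (p + q)"
proof (cases "p + q = 0")
  case True
  hence "p = 0" "q = 0" using assms by auto
  thus ?thesis by simp
next
  case False
  define s where "s = p + q"
  have s: "s > 0" using False assms by (simp add: s_def)
  have *: "x * ln x \<le> x * (ln s - ln 2 + (2 * x / s - 1))" if "0 \<le> x" for x
  proof (cases "x = 0")
    case False
    hence x: "x > 0" using that by simp
    have "ln x = ln s - ln 2 + ln (2 * x / s)"
      using x s by (simp add: ln_div ln_mult)
    moreover have "ln (2 * x / s) \<le> 2 * x / s - 1"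
      using x s by (intro ln_le_minus_one) simp
    ultimately show ?thesis using x by simp
  qed simp
  have "p * ln p + q * ln q \<le> (p + q) * (ln s - ln 2) + (p * (2 * p / s - 1) + q * (2 * q / s - 1))"
    using *[OF assms(1)] *[OF assms(2)] by (simp add: algebra_simps)
  moreover have "p * (2 * p / s - 1) + q * (2 * q / s - 1) = (p - q)\<^sup>2 / s"
    using s by (simp add: field_simps) (simp add: s_def power2_eq_square algebra_simps)
  ultimately show ?thesis by (simp add: s_def algebra_simps)
qed

text \<open>Convexity of the squared bias under mixing; the difference of the two sides is a square
  over a positive number. If a denominator is 0, the hypotheses make the matching numerator 0 as
  well.\<close>

lemma square_divide_subadditive:
  fixes a b c d :: real
  assumes "\<bar>a\<bar> \<le> c" "\<bar>b\<bar> \<le> d"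
  shows "(a + b)\<^sup>2 / (c + d) \<le> a\<^sup>2 / c + b\<^sup>2 / d"
proof (cases "c = 0 \<or> d = 0")
  case True
  thus ?thesis using assms by auto
next
  case False
  hence pos: "c > 0" "d > 0" using assms by auto
  have "a\<^sup>2 / c + b\<^sup>2 / d - (a + b)\<^sup>2 / (c + d) = (a * d - b * c)\<^sup>2 / (c * d * (c + d))"
    using pos by (simp add: divide_simps) (simp add: power2_eq_square algebra_simps)
  also have "\<dots> \<ge> 0" using pos by simp
  finally show ?thesis by simp
qed

lemma influence_nonneg:
  assumes "\<And>y. y \<in> Pow A \<Longrightarrow> 0 \<le> P y" "i \<in> A"
  shows "0 \<le> influence P A i"
  unfolding influence_def
proof (intro sum_nonneg divide_nonneg_nonneg)
  fix y assume "y \<in> Pow (A - {i})"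
  hence "y \<in> Pow A" "insert i y \<in> Pow A" using assms(2) by auto
  thus "0 \<le> P y + P (insert i y)" using assms(1) by (simp add: add_nonneg_nonneg)
qed simp

text \<open>Chain rule for the entropy of \<open>P\<close>; the bias of a coordinate given the previous ones is an average
  of its bias given all the others, so its mean square only grows.\<close>

lemma entropy_le_influence:
  assumes "finite A" "\<And>y. y \<in> Pow A \<Longrightarrow> 0 \<le> P y"
  shows "(\<Sum>y\<in>Pow A. P y * ln (P y)) \<le> (\<Sum>y\<in>Pow A. P y) * ln (\<Sum>y\<in>Pow A. P y)
      - real (card A) * ln 2 * (\<Sum>y\<in>Pow A. P y) + (\<Sum>i\<in>A. influence P A i)"
  using assms
proof (induction A arbitrary: P)
  case (insert u A)
  \<comment> \<open>The marginal of \<open>P\<close> after summing out the coordinate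
    \<open>u\<close>.\<close>
  define P' where "P' y = P y + P (insert u y)" for y
  define s where "s = (\<Sum>y\<in>Pow A. P' y)"
  have nonneg: "0 \<le> P y" "0 \<le> P (insert u y)" if "y \<in> Pow A" for y
    using that by (auto intro!: insert.prems)
  have s: "(\<Sum>y\<in>Pow (insert u A). P y) = s"
    unfolding sum_Pow_insert[OF insert.hyps] s_def P'_def ..
  have IH: "(\<Sum>y\<in>Pow A. P' y * ln (P' y)) \<le> s * ln s - real (card A) * ln 2 * s + (\<Sum>i\<in>A. influence P' A i)"
    unfolding s_def by (rule insert.IH) (auto simp: P'_def intro!: add_nonneg_nonneg nonneg)
  have Au: "insert u A - {u} = A" using insert.hyps by auto
  have "(\<Sum>y\<in>Pow (insert u A). P y * ln (P y))
      = (\<Sum>y\<in>Pow A. P y * ln (P y) + P (insert u y) * ln (P (insert u y)))"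
    by (rule sum_Pow_insert[OF insert.hyps])
  also have "\<dots> \<le> (\<Sum>y\<in>Pow A. P' y * ln (P' y) - P' y * ln 2
      + (P y - P (insert u y))\<^sup>2 / (P y + P (insert u y)))"
    unfolding P'_def by (intro sum_mono two_point_entropy nonneg)
  also have "\<dots> = (\<Sum>y\<in>Pow A. P' y * ln (P' y)) - s * ln 2 + influence P (insert u A) u"
    by (simp add: sum.distrib sum_subtractf s_def influence_def Au sum_distrib_right)
  finally have 1: "(\<Sum>y\<in>Pow (insert u A). P y * ln (P y))
    \<le> (\<Sum>y\<in>Pow A. P' y * ln (P' y)) - s * ln 2 + influence P (insert u A) u" .
  \<comment> \<open>Forgetting \<open>u\<close> averages the biases over its two values, which by
    convexity cannot raise the mean square.\<close>
  have "(\<Sum>i\<in>A. influence P' A i) \<le> (\<Sum>i\<in>A. influence P (insert u A) i)"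
  proof (rule sum_mono)
    fix i assume i: "i \<in> A"
    have set_eq: "insert u A - {i} = insert u (A - {i})" using i insert.hyps by auto
    have fin: "finite (A - {i})" "u \<notin> A - {i}" using insert.hyps by auto
    show "influence P' A i \<le> influence P (insert u A) i"
      unfolding influence_def set_eq sum_Pow_insert[OF fin]
    proof (rule sum_mono)
      fix y assume y: "y \<in> Pow (A - {i})"
      have "(P' y - P' (insert i y))\<^sup>2 / (P' y + P' (insert i y))
        = ((P y - P (insert i y)) + (P (insert u y) - P (insert i (insert u y))))\<^sup>2
          / ((P y + P (insert i y)) + (P (insert u y) + P (insert i (insert u y))))"
        by (simp add: P'_def insert_commute algebra_simps)
      also have "\<dots> \<le> (P y - P (insert i y))\<^sup>2 / (P y + P (insert i y))
        + (P (insert u y) - P (insert i (insert u y)))\<^sup>2 / (P (insert u y) + P (insert i (insert u y)))"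
      proof (rule square_divide_subadditive)
        have "0 \<le> P y" "0 \<le> P (insert i y)" "0 \<le> P (insert u y)" "0 \<le> P (insert i (insert u y))"
          using y i by (auto intro!: insert.prems)
        thus "\<bar>P y - P (insert i y)\<bar> \<le> P y + P (insert i y)"
          and "\<bar>P (insert u y) - P (insert i (insert u y))\<bar> \<le> P (insert u y) + P (insert i (insert u y))"
          by auto
      qed
      finally show "(P' y - P' (insert i y))\<^sup>2 / (P' y + P' (insert i y))
        \<le> (P y - P (insert i y))\<^sup>2 / (P y + P (insert i y))
        + (P (insert u y) - P (insert i (insert u y)))\<^sup>2 / (P (insert u y) + P (insert i (insert u y)))" .
    qed
  qed
  thus ?case
    using 1 IH insert.hyps unfolding s by (simp add: algebra_simps)
qed simp

text \<open>Entropy is additive over independent bits, and \<open>ln 2\<close> converts bits to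
  nats. For \<open>\<delta> = 0\<close> all masses are 0 or 1, so every term vanishes.\<close>

lemma sum_bern_ln_bern:
  assumes "finite A" "0 \<le> \<delta>" "\<delta> < 1"
  shows "(\<Sum>z\<in>Pow A. bern \<delta> A z * ln (bern \<delta> A z)) = - real (card A) * ln 2 * bin_entropy \<delta>"
proof (cases "\<delta> = 0")
  case True
  have "bern 0 A z * ln (bern 0 A z) = 0" for z
  proof (cases "\<exists>a\<in>A. a \<in> z")
    case True
    thus ?thesis using assms(1) by (auto simp: bern_def intro!: bexI)
  next
    case False
    thus ?thesis by (simp add: bern_def)
  qed
  hence "(\<Sum>z\<in>Pow A. bern 0 A z * ln (bern 0 A z)) = 0" by (intro sum.neutral ballI)
  thus ?thesis using True by (simp only: bin_entropy_def) simp
next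
  case False
  hence \<delta>: "0 < \<delta>" "\<delta> < 1" using assms by auto
  let ?H = "\<delta> * ln \<delta> + (1 - \<delta>) * ln (1 - \<delta>)"
  have "(\<Sum>z\<in>Pow A. bern \<delta> A z * ln (bern \<delta> A z)) = real (card A) * ?H"
    using assms(1)
  proof (induction A)
    case (insert u A)
    have pos: "bern \<delta> A z > 0" for z
      using \<delta> by (auto simp: bern_def intro!: prod_pos)
    have "(\<Sum>z\<in>Pow (insert u A). bern \<delta> (insert u A) z * ln (bern \<delta> (insert u A) z))
        = (\<Sum>z\<in>Pow A. ?H * bern \<delta> A z + bern \<delta> A z * ln (bern \<delta> A z))"
      unfolding sum_Pow_insert[OF insert.hyps]
    proof (rule sum.cong[OF refl])
      fix z assume "z \<in> Pow A"
      thus "bern \<delta> (insert u A) z * ln (bern \<delta> (insert u A) z)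
        + bern \<delta> (insert u A) (insert u z) * ln (bern \<delta> (insert u A) (insert u z))
        = ?H * bern \<delta> A z + bern \<delta> A z * ln (bern \<delta> A z)"
        using \<delta> pos[of z] by (simp add: bern_insert[OF insert.hyps] ln_mult) (simp add: algebra_simps)
    qed
    also have "\<dots> = ?H + real (card A) * ?H"
      by (simp add: sum.distrib insert.IH sum_bern insert.hyps flip: sum_distrib_left)
    finally show ?case using insert.hyps by (simp add: algebra_simps)
  qed (simp add: bern_def)
  moreover have "ln 2 * bin_entropy \<delta> = - ?H"
    using False by (simp add: bin_entropy_def log_def field_simps)
  ultimately show ?thesis by (simp add: mult.assoc) (simp add: algebra_simps)
qed

lemma sum_Pow_sym_diff:
  "c \<subseteq> A \<Longrightarrow> (\<Sum>y\<in>Pow A. f (sym_diff y c)) = (\<Sum>y\<in>Pow A. f y)"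
  by (rule sum.reindex_bij_witness[of _ "\<lambda>y. sym_diff y c" "\<lambda>y. sym_diff y c"])
    (auto intro!: arg_cong[of _ _ f])

text \<open>A random shift by one of \<open>card C\<close> codewords adds at most
  \<open>ln (card C)\<close> to the noise entropy. By \<open>entropy_le_influence\<close> the
  remaining deficit is covered by the influences, so some \<open>i\<close> has at least the average
  share. The function \<open>g\<close> is the bias of the received bit at \<open>i\<close> given the
  others; its sign rule under codewords reduces everything to the zero codeword.\<close>

lemma weak_prediction:
  fixes A :: "'a set" and C :: "'a set set"
  assumes A: "finite A" "A \<noteq> {}" and C: "C \<subseteq> Pow A" "C \<noteq> {}"
    and closed: "\<And>c d. c \<in> C \<Longrightarrow> d \<in> C \<Longrightarrow> sym_diff c d \<in> C"
    and \<delta>: "0 \<le> \<delta>" "\<delta> < 1/2"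
  obtains i g where "i \<in> A" "\<And>z. \<bar>g z\<bar> \<le> (1::real)" "\<And>z. g (z - {i}) = g z"
    "\<And>c z. c \<in> C \<Longrightarrow> g (sym_diff z c) = (if i \<in> c then - g z else g z)"
    "ln 2 * (1 - log 2 (card C) / card A - bin_entropy \<delta>) \<le> (\<Sum>z\<in>Pow (A - {i}). bern \<delta> (A - {i}) z * g z)"
proof -
  have finC: "finite C" using A C finite_subset by auto
  define k where "k = real (card C)"
  have k: "k > 0" using finC C by (auto simp: k_def card_gt_0_iff)
  have \<delta>1: "\<delta> \<le> 1" using \<delta> by simp
  \<comment> \<open>The law of the received word when the codeword is uniform on
    \<open>C\<close>.\<close>
  define P where "P y = (\<Sum>c\<in>C. bern \<delta> A (sym_diff y c)) / k" for y
  have P_nonneg: "0 \<le> P y" for y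
    unfolding P_def using k by (intro divide_nonneg_nonneg sum_nonneg bern_nonneg \<delta> \<delta>1) auto
  have P_sum: "(\<Sum>y\<in>Pow A. P y * F y) = (\<Sum>c\<in>C. \<Sum>z\<in>Pow A. bern \<delta> A z * F (sym_diff z c)) / k" for F
  proof -
    have "(\<Sum>y\<in>Pow A. bern \<delta> A (sym_diff y c) * F y) = (\<Sum>z\<in>Pow A. bern \<delta> A z * F (sym_diff z c))"
      if "c \<in> C" for c
    proof -
      have *: "sym_diff (sym_diff y c) c = y" for y by auto
      show ?thesis
        using sum_Pow_sym_diff[of c A "\<lambda>z. bern \<delta> A z * F (sym_diff z c)"] that C
        unfolding * by auto
    qed
    hence "(\<Sum>c\<in>C. \<Sum>y\<in>Pow A. bern \<delta> A (sym_diff y c) * F y)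
        = (\<Sum>c\<in>C. \<Sum>z\<in>Pow A. bern \<delta> A z * F (sym_diff z c))" by simp
    moreover have "(\<Sum>y\<in>Pow A. P y * F y) = (\<Sum>y\<in>Pow A. \<Sum>c\<in>C. bern \<delta> A (sym_diff y c) * F y) / k"
      by (simp add: P_def sum_distrib_right sum_divide_distrib)
    ultimately show ?thesis by (subst (asm) (1) sum.swap) simp
  qed
  have P_total: "(\<Sum>y\<in>Pow A. P y) = 1"
    using P_sum[of "\<lambda>_. 1"] k by (simp add: sum_bern A(1) k_def)
  have P_inv: "P (sym_diff y c) = P y" if c: "c \<in> C" for y c
  proof -
    have "(\<Sum>d\<in>C. bern \<delta> A (sym_diff (sym_diff y c) d)) = (\<Sum>d\<in>C. bern \<delta> A (sym_diff y d))"
      by (rule sum.reindex_bij_witness[of _ "\<lambda>d. sym_diff c d" "\<lambda>d. sym_diff c d"])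
        (use closed[OF c] in \<open>auto intro!: arg_cong[of _ _ "bern \<delta> A"]\<close>)
    thus ?thesis by (simp add: P_def)
  qed

  \<comment> \<open>Upper bound on the entropy of \<open>P\<close>: the mixture is at least
    \<open>1 / k\<close> times its summand for the codeword actually sent.\<close>
  have "- ln k - real (card A) * ln 2 * bin_entropy \<delta>
      = (\<Sum>c\<in>C. - ln k - real (card A) * ln 2 * bin_entropy \<delta>) / k"
    using k by (simp add: k_def)
  also have "\<dots> \<le> (\<Sum>c\<in>C. \<Sum>z\<in>Pow A. bern \<delta> A z * ln (P (sym_diff z c))) / k"
  proof (intro divide_right_mono sum_mono)
    fix c assume c: "c \<in> C"
    have "bern \<delta> A z * (ln (bern \<delta> A z) - ln k) \<le> bern \<delta> A z * ln (P (sym_diff z c))" for z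
    proof (cases "bern \<delta> A z = 0")
      case False
      hence pos: "bern \<delta> A z > 0" using bern_nonneg[OF \<delta>(1) \<delta>1, of A z] by simp
      have "sym_diff (sym_diff z c) c = z" by auto
      hence "bern \<delta> A z / k \<le> P (sym_diff z c)"
        unfolding P_def using k finC c bern_nonneg[OF \<delta>(1) \<delta>1]
          member_le_sum[of c C "\<lambda>d. bern \<delta> A (sym_diff (sym_diff z c) d)"]
        by (intro divide_right_mono) auto
      hence "ln (bern \<delta> A z / k) \<le> ln (P (sym_diff z c))"
        using pos k by (intro ln_mono) auto
      thus ?thesis using pos k by (simp add: ln_div)
    qed simp
    hence "(\<Sum>z\<in>Pow A. bern \<delta> A z * (ln (bern \<delta> A z) - ln k))
        \<le> (\<Sum>z\<in>Pow A. bern \<delta> A z * ln (P (sym_diff z c)))" by (intro sum_mono)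
    moreover have "(\<Sum>z\<in>Pow A. bern \<delta> A z * (ln (bern \<delta> A z) - ln k))
        = - ln k - real (card A) * ln 2 * bin_entropy \<delta>"
      using \<delta> by (simp add: right_diff_distrib sum_subtractf sum_bern_ln_bern A(1) sum_bern
          flip: sum_distrib_right)
    ultimately show "- ln k - real (card A) * ln 2 * bin_entropy \<delta>
        \<le> (\<Sum>z\<in>Pow A. bern \<delta> A z * ln (P (sym_diff z c)))" by simp
  qed (use k in simp)
  also have "\<dots> = (\<Sum>y\<in>Pow A. P y * ln (P y))" by (rule P_sum[symmetric])
  also have "\<dots> \<le> - real (card A) * ln 2 + (\<Sum>i\<in>A. influence P A i)"
    using entropy_le_influence[of A P] A(1) P_nonneg by (simp add: P_total)
  finally have total: "real (card A) * ln 2 - ln k - real (card A) * ln 2 * bin_entropy \<delta>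
      \<le> (\<Sum>i\<in>A. influence P A i)" by simp

  define \<epsilon> where "\<epsilon> = ln 2 * (1 - log 2 (card C) / card A - bin_entropy \<delta>)"
  have "\<exists>i\<in>A. \<epsilon> \<le> influence P A i"
  proof (rule ccontr)
    assume "\<not> (\<exists>i\<in>A. \<epsilon> \<le> influence P A i)"
    hence "(\<Sum>i\<in>A. influence P A i) < (\<Sum>i\<in>A. \<epsilon>)"
      using A by (intro sum_strict_mono) auto
    also have "\<dots> = real (card A) * ln 2 - ln k - real (card A) * ln 2 * bin_entropy \<delta>"
      using A by (simp add: \<epsilon>_def k_def log_def field_simps)
    finally show False using total by simp
  qed
  then obtain i where i: "i \<in> A" "\<epsilon> \<le> influence P A i" by blast

  \<comment> \<open>The conditional expectation of the sign of the symbol at \<open>i\<close> given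
    the other symbols; it is 0 where both likelihoods vanish.\<close>
  define g where "g z = (P (z - {i}) - P (insert i z)) / (P (z - {i}) + P (insert i z))" for z
  have g_bound: "\<bar>g z\<bar> \<le> 1" for z
    using P_nonneg[of "z - {i}"] P_nonneg[of "insert i z"] by (auto simp: g_def abs_divide divide_le_eq_1)
  have g_remove: "g (z - {i}) = g z" for z by (simp add: g_def)
  have g_insert: "g (insert i z) = g z" for z
    using g_remove[of z] g_remove[of "insert i z"] by simp
  \<comment> \<open>\<open>P\<close> is invariant under codewords, and a codeword containing
    \<open>i\<close> exchanges the two likelihoods that \<open>g\<close> compares.\<close>
  have g_flip: "g (sym_diff z c) = (if i \<in> c then - g z else g z)" if c: "c \<in> C" for c z
  proof (cases "i \<in> c")
    case True
    have "sym_diff z c - {i} = sym_diff (insert i z) c" "insert i (sym_diff z c) = sym_diff (z - {i}) c"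
      using True by auto
    hence "g (sym_diff z c) = (P (insert i z) - P (z - {i})) / (P (insert i z) + P (z - {i}))"
      using P_inv[OF c] by (simp add: g_def)
    thus ?thesis using True by (simp add: g_def add.commute minus_divide_left)
  next
    case False
    have *: "sym_diff z c - {i} = sym_diff (z - {i}) c" "insert i (sym_diff z c) = sym_diff (insert i z) c"
      using False by auto
    have "g (sym_diff z c) = g z" unfolding g_def * P_inv[OF c] ..
    thus ?thesis using False by simp
  qed

  \<comment> \<open>The influence is the correlation of \<open>g\<close> with the sign
    \<open>\<sigma>\<close>. Both change sign under the same codewords, so their product is
    invariant and the average over \<open>C\<close> disappears.\<close>
  define \<sigma> :: "'a set \<Rightarrow> real" where "\<sigma> z = (if i \<in> z then - 1 else 1)" for z
  have split: "A = insert i (A - {i})" "finite (A - {i})" "i \<notin> A - {i}" using i A by auto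
  have "influence P A i = (\<Sum>y\<in>Pow (A - {i}). P y * (\<sigma> y * g y) + P (insert i y) * (\<sigma> (insert i y) * g (insert i y)))"
    unfolding influence_def
  proof (rule sum.cong[OF refl])
    fix y assume "y \<in> Pow (A - {i})"
    hence "i \<notin> y" by auto
    thus "(P y - P (insert i y))\<^sup>2 / (P y + P (insert i y))
      = P y * (\<sigma> y * g y) + P (insert i y) * (\<sigma> (insert i y) * g (insert i y))"
      unfolding g_insert by (simp add: g_def \<sigma>_def power2_eq_square algebra_simps diff_divide_distrib add_divide_distrib)
  qed
  also have "\<dots> = (\<Sum>y\<in>Pow A. P y * (\<sigma> y * g y))"
    by (subst (2) split(1)) (rule sum_Pow_insert[OF split(2,3), symmetric])
  also have "\<dots> = (\<Sum>c\<in>C. \<Sum>z\<in>Pow A. bern \<delta> A z * (\<sigma> z * g z)) / k"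
    unfolding P_sum
    by (intro arg_cong2[of _ _ _ _ "(/)"] sum.cong refl) (auto simp: g_flip \<sigma>_def)
  also have "\<dots> = (\<Sum>z\<in>Pow A. bern \<delta> A z * (\<sigma> z * g z))"
    using k by (simp add: k_def)
  \<comment> \<open>Since \<open>g\<close> ignores \<open>i\<close>, the noise at \<open>i\<close>
    can be averaged out; its sign has mean \<open>1 - 2 * \<delta>\<close>.\<close>
  also have "\<dots> = (\<Sum>z\<in>Pow (A - {i}). (1 - 2 * \<delta>) * (bern \<delta> (A - {i}) z * g z))"
  proof (subst (1 2) split(1), subst sum_Pow_insert[OF split(2,3)], rule sum.cong[OF refl])
    fix z assume z: "z \<in> Pow (A - {i})"
    hence "i \<notin> z" by auto
    thus "bern \<delta> (insert i (A - {i})) z * (\<sigma> z * g z)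
      + bern \<delta> (insert i (A - {i})) (insert i z) * (\<sigma> (insert i z) * g (insert i z))
      = (1 - 2 * \<delta>) * (bern \<delta> (A - {i}) z * g z)"
      using z by (simp add: bern_insert[OF split(2,3)] g_insert \<sigma>_def algebra_simps del: insert_Diff_single)
  qed
  also have "\<dots> = (1 - 2 * \<delta>) * (\<Sum>z\<in>Pow (A - {i}). bern \<delta> (A - {i}) z * g z)"
    by (rule sum_distrib_left[symmetric])
  finally have mean: "influence P A i = (1 - 2 * \<delta>) * (\<Sum>z\<in>Pow (A - {i}). bern \<delta> (A - {i}) z * g z)" .
  \<comment> \<open>Dropping a factor in the interval from 0 to 1 gives an upper bound only once the
    correlation is known to be nonnegative.\<close>
  have "0 \<le> influence P A i" using P_nonneg i(1) by (intro influence_nonneg) auto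
  hence "0 \<le> (\<Sum>z\<in>Pow (A - {i}). bern \<delta> (A - {i}) z * g z)"
    using mean \<delta> by (simp add: zero_le_mult_iff)
  hence "influence P A i \<le> (\<Sum>z\<in>Pow (A - {i}). bern \<delta> (A - {i}) z * g z)"
    unfolding mean using \<delta> by (intro mult_left_le_one_le) auto
  hence "\<epsilon> \<le> (\<Sum>z\<in>Pow (A - {i}). bern \<delta> (A - {i}) z * g z)" using i(2) by simp
  thus ?thesis using that[OF i(1) g_bound g_remove g_flip] unfolding \<epsilon>_def by blast
qed

section \<open>Restriction of Reed--Muller codes to affine graphs\<close>

definition rm_code :: "nat \<Rightarrow> nat \<Rightarrow> nat set set set" where
  "rm_code m r = (\<lambda>U. {p \<in> rm_points m. rm_eval U p}) ` rm_coeffs m r"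

text \<open>Predicate form of the code. Values outside \<open>rm_points m\<close> are ignored, so
  products and substitutions can be written down without restricting them first.\<close>

definition rm_fun :: "nat \<Rightarrow> nat \<Rightarrow> (nat set \<Rightarrow> bool) \<Rightarrow> bool" where
  "rm_fun m r f \<longleftrightarrow> (\<exists>U\<in>rm_coeffs m r. \<forall>x\<in>rm_points m. f x = rm_eval U x)"

lemma finite_rm_monos [simp]: "finite (rm_monos m r)"
  by (simp add: rm_monos_def)

lemma finite_rm_points [simp]: "finite (rm_points m)"
  by (simp add: rm_points_def)

lemma card_rm_points [simp]: "card (rm_points m) = 2 ^ m"
  by (simp add: rm_points_def card_Pow)

lemma finite_rm_coeffs [simp]: "finite (rm_coeffs m r)"
  by (simp add: rm_coeffs_def)

lemma finite_of_rm_coeffs: "U \<in> rm_coeffs m r \<Longrightarrow> finite U"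
  by (auto simp: rm_coeffs_def intro: finite_subset[OF _ finite_rm_monos])

lemma card_rm_monos: "card (rm_monos m r) = binom_le m r"
proof -
  have "rm_monos m r = (\<Union>i\<in>{..r}. {A. A \<subseteq> {..<m} \<and> card A = i})"
    by (auto simp: rm_monos_def)
  also have "card \<dots> = (\<Sum>i\<in>{..r}. card {A. A \<subseteq> {..<m} \<and> card A = i})"
    by (rule card_UN_disjoint) (auto intro: finite_subset[of _ "Pow {..<m}"])
  finally show ?thesis by (simp add: n_subsets binom_le_def)
qed

lemma odd_card_sym_diff:
  assumes "finite A" "finite B"
  shows "odd (card (sym_diff A B)) \<longleftrightarrow> odd (card A) \<noteq> odd (card B)"
proof -
  have "card (sym_diff A B) = card (A - B) + card (B - A)"
    using assms by (intro card_Un_disjoint) auto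
  moreover have "card A = card (A - B) + card (A \<inter> B)" "card B = card (B - A) + card (A \<inter> B)"
    using assms by (subst card_Un_disjoint[symmetric]; auto intro!: arg_cong[of _ _ card])+
  ultimately show ?thesis by auto
qed

lemma rm_eval_sym_diff:
  assumes "finite U" "finite V"
  shows "rm_eval (sym_diff U V) x \<longleftrightarrow> rm_eval U x \<noteq> rm_eval V x"
proof -
  have "{A \<in> sym_diff U V. A \<subseteq> x} = sym_diff {A \<in> U. A \<subseteq> x} {A \<in> V. A \<subseteq> x}" by auto
  thus ?thesis using assms odd_card_sym_diff[of "{A \<in> U. A \<subseteq> x}" "{A \<in> V. A \<subseteq> x}"]
    by (simp only: rm_eval_def) simp
qed

lemma rm_eval_empty [simp]: "\<not> rm_eval {} x"
  by (simp add: rm_eval_def)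

lemma rm_eval_insert:
  assumes "finite U" "A \<notin> U"
  shows "rm_eval (insert A U) x \<longleftrightarrow> (A \<subseteq> x) \<noteq> rm_eval U x"
proof -
  have "{B \<in> insert A U. B \<subseteq> x} = (if A \<subseteq> x then insert A {B \<in> U. B \<subseteq> x} else {B \<in> U. B \<subseteq> x})" by auto
  thus ?thesis using assms by (simp add: rm_eval_def)
qed

lemma rm_fun_xor:
  assumes "rm_fun m r f" "rm_fun m r g"
  shows "rm_fun m r (\<lambda>x. f x \<noteq> g x)"
proof -
  obtain U V where UV: "U \<in> rm_coeffs m r" "V \<in> rm_coeffs m r"
    "\<forall>x\<in>rm_points m. f x = rm_eval U x" "\<forall>x\<in>rm_points m. g x = rm_eval V x"
    using assms by (auto simp: rm_fun_def)
  hence "\<forall>x\<in>rm_points m. (f x \<noteq> g x) = rm_eval (sym_diff U V) x"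
    by (subst rm_eval_sym_diff) (auto dest: finite_of_rm_coeffs)
  moreover have "sym_diff U V \<in> rm_coeffs m r" using UV by (auto simp: rm_coeffs_def)
  ultimately show ?thesis unfolding rm_fun_def by blast
qed

lemma rm_fun_mono: "r \<le> s \<Longrightarrow> rm_fun m r f \<Longrightarrow> rm_fun m s f"
proof -
  assume "r \<le> s"
  hence "rm_coeffs m r \<subseteq> rm_coeffs m s" by (auto simp: rm_coeffs_def rm_monos_def)
  thus "rm_fun m r f \<Longrightarrow> rm_fun m s f" unfolding rm_fun_def by blast
qed

lemma rm_fun_monomial:
  assumes "A \<subseteq> {..<m}" "card A \<le> r"
  shows "rm_fun m r (\<lambda>x. A \<subseteq> x)"
  unfolding rm_fun_def using assms
  by (intro bexI[of _ "{A}"]) (auto simp: rm_eval_insert rm_coeffs_def rm_monos_def)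

lemma rm_fun_False: "rm_fun m r (\<lambda>_. False)"
  unfolding rm_fun_def by (intro bexI[of _ "{}"]) (auto simp: rm_coeffs_def)

lemma rm_fun_cong: "rm_fun m r f \<Longrightarrow> (\<And>x. x \<in> rm_points m \<Longrightarrow> f x = g x) \<Longrightarrow> rm_fun m r g"
  by (simp add: rm_fun_def)

text \<open>Adding a monomial to \<open>U\<close> is an xor, which is compatible with multiplication
  by \<open>h\<close> and substitution of \<open>e\<close>, so monomials suffice. It is used with
  \<open>h\<close> a coordinate and \<open>e\<close> the identity, and with \<open>h\<close> true
  and \<open>e\<close> affine.\<close>

lemma rm_fun_linear_extension:
  assumes mono: "\<And>A. A \<in> rm_monos m r \<Longrightarrow> rm_fun n s (\<lambda>x. h x \<and> A \<subseteq> e x)"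
    and f: "rm_fun m r f" and e: "\<And>x. x \<in> rm_points n \<Longrightarrow> e x \<in> rm_points m"
  shows "rm_fun n s (\<lambda>x. h x \<and> f (e x))"
proof -
  obtain U where U: "U \<in> rm_coeffs m r" "\<forall>x\<in>rm_points m. f x = rm_eval U x"
    using f by (auto simp: rm_fun_def)
  have "finite U" using U(1) by (rule finite_of_rm_coeffs)
  moreover have "U \<subseteq> rm_monos m r" using U(1) by (simp add: rm_coeffs_def)
  ultimately have "rm_fun n s (\<lambda>x. h x \<and> rm_eval U (e x))"
  proof (induction U)
    case empty
    show ?case by (rule rm_fun_cong[OF rm_fun_False]) simp
  next
    case (insert A U)
    have "rm_fun n s (\<lambda>x. (h x \<and> A \<subseteq> e x) \<noteq> (h x \<and> rm_eval U (e x)))"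
      using insert by (intro rm_fun_xor mono) auto
    thus ?case by (rule rm_fun_cong) (auto simp: rm_eval_insert insert.hyps)
  qed
  thus ?thesis by (rule rm_fun_cong) (auto simp: U(2) e)
qed

text \<open>Over \<open>F_2\<close> squares of coordinates collapse, so a monomial \<open>A\<close>
  times coordinate \<open>j\<close> is the monomial \<open>insert j A\<close>.\<close>

lemma rm_fun_coordinate_mult:
  assumes "rm_fun m r f" "j < m"
  shows "rm_fun m (Suc r) (\<lambda>x. j \<in> x \<and> f x)"
proof (rule rm_fun_linear_extension[of m r m "Suc r" _ "\<lambda>x. x", OF _ assms(1)])
  fix A assume A: "A \<in> rm_monos m r"
  have "card (insert j A) \<le> Suc r"
    using A card_insert_le_m1[of "Suc r" A j] by (simp add: rm_monos_def)
  hence "rm_fun m (Suc r) (\<lambda>x. insert j A \<subseteq> x)"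
    using A assms(2) by (intro rm_fun_monomial) (auto simp: rm_monos_def)
  thus "rm_fun m (Suc r) (\<lambda>x. j \<in> x \<and> A \<subseteq> x)" by simp
qed simp

text \<open>The factor is an affine form with constant \<open>c\<close> and linear part summed over
  \<open>M\<close>; it is built up one coordinate at a time.\<close>

lemma rm_fun_affine_mult:
  assumes "rm_fun m r f" "M \<subseteq> {..<m}"
  shows "rm_fun m (Suc r) (\<lambda>x. c \<noteq> odd (card (x \<inter> M)) \<and> f x)"
proof -
  have "finite M" using assms(2) finite_subset by blast
  thus ?thesis using assms(2)
  proof (induction M)
    case empty
    show ?case
    proof (cases c)
      case True
      thus ?thesis using rm_fun_mono[OF _ assms(1), of "Suc r"] by simp
    next
      case False
      thus ?thesis using rm_fun_False by simp
    qed
  next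
    case (insert j M)
    have "rm_fun m (Suc r) (\<lambda>x. (c \<noteq> odd (card (x \<inter> M)) \<and> f x) \<noteq> (j \<in> x \<and> f x))"
      using insert by (intro rm_fun_xor rm_fun_coordinate_mult assms(1)) auto
    thus ?case by (rule rm_fun_cong) (auto simp: insert.hyps)
  qed
qed

text \<open>A monomial \<open>A\<close> turns into a product of \<open>card A\<close> affine forms,
  so affine substitution does not raise the degree.\<close>

lemma rm_fun_affine_subst:
  assumes f: "rm_fun m r f" and M: "\<And>j. M j \<subseteq> {..<n}"
  shows "rm_fun n r (\<lambda>u. f {j \<in> {..<m}. c j \<noteq> odd (card (u \<inter> M j))})"
proof -
  let ?e = "\<lambda>u. {j \<in> {..<m}. c j \<noteq> odd (card (u \<inter> M j))}"
  have "rm_fun n r (\<lambda>u. True \<and> f (?e u))"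
  proof (rule rm_fun_linear_extension[OF _ f])
    fix A assume A: "A \<in> rm_monos m r"
    have "rm_fun n (card A) (\<lambda>u. A \<subseteq> ?e u)" if "finite A" "A \<subseteq> {..<m}" for A
      using that
    proof (induction A)
      case empty
      show ?case using rm_fun_monomial[of "{}" n 0] by simp
    next
      case (insert j A)
      have "rm_fun n (Suc (card A)) (\<lambda>u. c j \<noteq> odd (card (u \<inter> M j)) \<and> A \<subseteq> ?e u)"
        using insert by (intro rm_fun_affine_mult M) auto
      moreover have "card (insert j A) = Suc (card A)" using insert.hyps by simp
      moreover have "insert j A \<subseteq> ?e u \<longleftrightarrow> (c j \<noteq> odd (card (u \<inter> M j)) \<and> A \<subseteq> ?e u)" for u
        using insert.prems by auto
      ultimately show ?case by presburger
    qed
    moreover have "finite A" "A \<subseteq> {..<m}" "card A \<le> r"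
      using A finite_subset[of A "{..<m}"] by (auto simp: rm_monos_def)
    ultimately show "rm_fun n r (\<lambda>u. True \<and> A \<subseteq> ?e u)"
      using rm_fun_mono by simp
  qed (auto simp: rm_points_def)
  thus ?thesis by simp
qed

section \<open>Linearity and size of the code\<close>

lemma rm_code_iff: "c \<in> rm_code m r \<longleftrightarrow> c \<subseteq> rm_points m \<and> rm_fun m r (\<lambda>x. x \<in> c)"
  by (auto simp: rm_code_def rm_fun_def)

lemma rm_code_sym_diff: "c \<in> rm_code m r \<Longrightarrow> d \<in> rm_code m r \<Longrightarrow> sym_diff c d \<in> rm_code m r"
  unfolding rm_code_iff using rm_fun_xor[of m r "\<lambda>x. x \<in> c" "\<lambda>x. x \<in> d"]
  by (auto elim!: rm_fun_cong)

lemma finite_rm_code: "finite (rm_code m r)"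
  by (simp add: rm_code_def)

lemma empty_in_rm_code: "{} \<in> rm_code m r"
  by (simp add: rm_code_iff rm_fun_False)

lemma log_card_rm_code: "log 2 (card (rm_code m r)) \<le> binom_le m r"
proof -
  have "card (rm_code m r) \<le> card (rm_coeffs m r)"
    unfolding rm_code_def by (rule card_image_le) simp
  also have "\<dots> = 2 ^ binom_le m r" by (simp add: rm_coeffs_def card_Pow card_rm_monos)
  finally have "real (card (rm_code m r)) \<le> 2 ^ binom_le m r" by (metis of_nat_le_iff of_nat_numeral of_nat_power)
  moreover have "card (rm_code m r) > 0"
    using empty_in_rm_code[of m r] finite_rm_code[of m r] by (auto simp: card_gt_0_iff)
  ultimately show ?thesis by (subst log_le_iff) (auto simp: powr_realpow)
qed

text \<open>The affine map \<open>u \<mapsto> x + (v, B v)\<close> with \<open>v = u - i\<close>, where \<open>B\<close> is a 0-1 matrix with rows indexed by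
  \<open>{m'..<m}\<close> and columns by \<open>{..<m'}\<close>.\<close>

definition graph_map :: "nat \<Rightarrow> nat \<Rightarrow> nat set \<Rightarrow> nat set \<Rightarrow> (nat \<times> nat) set \<Rightarrow> nat set \<Rightarrow> nat set" where
  "graph_map m m' i x B u = {j \<in> {..<m}. (j \<in> x) \<noteq>
     (if j < m' then (j \<in> u) \<noteq> (j \<in> i) else odd (card {k \<in> sym_diff u i. (k, j) \<in> B}))}"

lemma graph_map_in_points: "graph_map m m' i x B u \<in> rm_points m"
  by (auto simp: graph_map_def rm_points_def)

lemma graph_map_base: "x \<in> rm_points m \<Longrightarrow> graph_map m m' i x B i = x"
  by (auto simp: graph_map_def rm_points_def)

text \<open>The first \<open>m'\<close> coordinates of the image are those of
  \<open>x + u + i\<close> whatever the matrix is, so they determine \<open>u\<close>.\<close>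

lemma graph_map_eq_imp:
  assumes "m' \<le> m" "u \<in> rm_points m'" "u' \<in> rm_points m'"
    and "graph_map m m' i x B u = graph_map m m' i x B' u'"
  shows "u = u'"
proof -
  have "j \<in> u \<longleftrightarrow> j \<in> u'" if "j < m'" for j
  proof -
    have "j \<in> graph_map m m' i x B u \<longleftrightarrow> j \<in> graph_map m m' i x B' u'" using assms(4) by simp
    thus ?thesis using that assms(1) by (auto simp: graph_map_def)
  qed
  thus ?thesis using assms(2,3) by (auto simp: rm_points_def)
qed

lemma graph_map_pullback:
  assumes c: "c \<in> rm_code m r" and i: "i \<in> rm_points m'"
  shows "{u \<in> rm_points m'. graph_map m m' i x B u \<in> c} \<in> rm_code m' r"
proof -
  \<comment> \<open>Coordinate \<open>j\<close> of the map is an affine form in \<open>u\<close>: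
    \<open>M j\<close> is its linear part, and \<open>a j\<close> is its constant, which absorbs the
    shifts by \<open>x\<close> and \<open>i\<close>.\<close>
  define M where "M j = (if j < m' then {j} else {k \<in> {..<m'}. (k, j) \<in> B})" for j
  define a where "a j = ((j \<in> x) \<noteq> odd (card (i \<inter> M j)))" for j
  have M: "M j \<subseteq> {..<m'}" for j by (auto simp: M_def)
  have eq: "graph_map m m' i x B u = {j \<in> {..<m}. a j \<noteq> odd (card (u \<inter> M j))}"
    if u: "u \<in> rm_points m'" for u
  proof -
    have sub: "u \<subseteq> {..<m'}" "i \<subseteq> {..<m'}" using u i by (auto simp: rm_points_def)
    hence fin: "finite (u \<inter> M j)" "finite (i \<inter> M j)" for j using finite_subset by blast+
    have "(if j < m' then (j \<in> u) \<noteq> (j \<in> i) else odd (card {k \<in> sym_diff u i. (k, j) \<in> B}))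
        \<longleftrightarrow> odd (card (u \<inter> M j)) \<noteq> odd (card (i \<inter> M j))" for j
    proof (cases "j < m'")
      case True
      thus ?thesis by (simp add: M_def Int_insert_right)
    next
      case False
      have "{k \<in> sym_diff u i. (k, j) \<in> B} = sym_diff (u \<inter> M j) (i \<inter> M j)"
        using sub False by (auto simp: M_def)
      thus ?thesis using odd_card_sym_diff[OF fin, of j j] False by simp
    qed
    thus ?thesis by (auto simp: graph_map_def a_def)
  qed
  have "rm_fun m' r (\<lambda>u. {j \<in> {..<m}. a j \<noteq> odd (card (u \<inter> M j))} \<in> c)"
    using c M by (intro rm_fun_affine_subst[of m r "\<lambda>x. x \<in> c"]) (auto simp: rm_code_iff)
  thus ?thesis unfolding rm_code_iff
    by (auto elim!: rm_fun_cong simp: eq)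
qed

text \<open>Toggling entries in one column at which \<open>u\<close> and \<open>i\<close> differ
  changes the last \<open>m - m'\<close> coordinates of the image in an arbitrary prescribed way. So
  colliding pairs, each combined with any toggle set, embed into all pairs.\<close>

lemma graph_map_collisions:
  fixes m' m :: nat
  defines "F \<equiv> Pow ({..<m'} \<times> {m'..<m})"
  assumes u: "u \<in> rm_points m'" and i: "i \<in> rm_points m'" and ne: "u \<noteq> i"
  shows "real (card {(B, B') \<in> F \<times> F. graph_map m m' i x B u = graph_map m m' i x B' u})
    \<le> 1 / 2 ^ (m - m') * (real (card F))\<^sup>2"
proof -
  define D where "D = sym_diff u i"
  define par where "par B j = odd (card {k \<in> D. (k, j) \<in> B})" for B :: "(nat \<times> nat) set" and j
  obtain k where k: "k \<in> D" using ne by (auto simp: D_def)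
  have D: "D \<subseteq> {..<m'}" using u i by (auto simp: D_def rm_points_def)
  hence finD: "finite D" using finite_subset by blast
  have finF: "finite F" by (simp add: F_def)
  define E where "E = {(B, B') \<in> F \<times> F. graph_map m m' i x B u = graph_map m m' i x B' u}"
  have E: "par B j = par B' j" if "(B, B') \<in> E" "j \<in> {m'..<m}" for B B' j
  proof -
    have "j \<in> graph_map m m' i x B u \<longleftrightarrow> j \<in> graph_map m m' i x B' u" using that by (simp add: E_def)
    thus ?thesis using that(2) by (auto simp: graph_map_def par_def D_def)
  qed
  have shift: "par (sym_diff B ({k} \<times> s)) j \<longleftrightarrow> par B j \<noteq> (j \<in> s)" for B s j
  proof (cases "j \<in> s")
    case True
    have "{l \<in> D. (l, j) \<in> sym_diff B ({k} \<times> s)} = sym_diff {l \<in> D. (l, j) \<in> B} {k}"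
      using True k by auto
    thus ?thesis using odd_card_sym_diff[of "{l \<in> D. (l, j) \<in> B}" "{k}"] finD True
      by (simp only: par_def) simp
  next
    case False
    hence "{l \<in> D. (l, j) \<in> sym_diff B ({k} \<times> s)} = {l \<in> D. (l, j) \<in> B}" by auto
    thus ?thesis using False by (simp only: par_def) simp
  qed
  \<comment> \<open>A collision gives \<open>B\<close> and \<open>B'\<close> equal row parities, so
    comparing the parities of the toggled matrix with those of \<open>B'\<close> recovers
    \<open>s\<close>, and then \<open>B\<close>.\<close>
  define \<phi> where "\<phi> = (\<lambda>((B, B' :: (nat \<times> nat) set), s :: nat set). (sym_diff B ({k} \<times> s), B'))"
  have "card (E \<times> Pow {m'..<m}) \<le> card (F \<times> F)"
  proof (rule card_inj_on_le)
    show "inj_on \<phi> (E \<times> Pow {m'..<m})"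
    proof (rule inj_onI)
      fix p q assume p: "p \<in> E \<times> Pow {m'..<m}" and q: "q \<in> E \<times> Pow {m'..<m}" and eq: "\<phi> p = \<phi> q"
      obtain B B' s where p': "p = ((B, B'), s)" by (metis surj_pair)
      obtain C C' t where q': "q = ((C, C'), t)" by (metis surj_pair)
      have 1: "sym_diff B ({k} \<times> s) = sym_diff C ({k} \<times> t)" "B' = C'"
        using eq by (simp_all add: \<phi>_def p' q')
      have "j \<in> s \<longleftrightarrow> j \<in> t" if "j \<in> {m'..<m}" for j
      proof -
        have "par B j = par C j"
          using E[of B B' j] E[of C C' j] p q that 1(2) by (simp add: p' q')
        moreover have "par B j \<noteq> (j \<in> s) \<longleftrightarrow> par C j \<noteq> (j \<in> t)"
          unfolding shift[symmetric] 1(1) ..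
        ultimately show ?thesis by auto
      qed
      hence "s = t" using p q by (auto simp: p' q')
      moreover from this have "B = C" using 1(1) by blast
      ultimately show "p = q" using 1(2) by (simp add: p' q')
    qed
    have "k \<in> {..<m'}" using k D by auto
    thus "\<phi> ` (E \<times> Pow {m'..<m}) \<subseteq> F \<times> F"
      by (auto simp: \<phi>_def E_def F_def)
    show "finite (F \<times> F)" using finF by simp
  qed
  hence "card E * 2 ^ (m - m') \<le> (card F)\<^sup>2"
    by (simp add: card_cartesian_product card_Pow power2_eq_square)
  hence "real (card E) * 2 ^ (m - m') \<le> (real (card F))\<^sup>2"
    by (metis (mono_tags, lifting) of_nat_le_iff of_nat_mult of_nat_numeral of_nat_power)
  thus ?thesis unfolding E_def by (simp add: field_simps)
qed

section \<open>Boosting\<close>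

text \<open>Grouping outcomes by the received word gives a sum whose terms a MAP rule minimises one
  by one.\<close>

lemma bit_error_eq_sum_joint:
  "bit_error m r \<delta> x d = (\<Sum>y\<in>Pow (rm_points m). rm_joint m r \<delta> x (\<not> d y) y)"
proof -
  define w where "w U z y = (if d y \<noteq> rm_eval U x then rm_weight m r \<delta> U z else 0)" for U z y
  have rec: "rm_received m U z \<in> Pow (rm_points m)" for U z by (auto simp: rm_received_def)
  have "(\<Sum>y\<in>Pow (rm_points m). rm_joint m r \<delta> x (\<not> d y) y)
      = (\<Sum>y\<in>Pow (rm_points m). \<Sum>U\<in>rm_coeffs m r. \<Sum>z\<in>Pow (rm_points m).
          if y = rm_received m U z then w U z y else 0)"
    unfolding rm_joint_def by (intro sum.cong refl) (auto simp: w_def)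
  also have "\<dots> = (\<Sum>U\<in>rm_coeffs m r. \<Sum>z\<in>Pow (rm_points m). \<Sum>y\<in>Pow (rm_points m).
          if y = rm_received m U z then w U z y else 0)"
    by (subst sum.swap, rule sum.cong[OF refl]) (rule sum.swap)
  also have "\<dots> = (\<Sum>U\<in>rm_coeffs m r. \<Sum>z\<in>Pow (rm_points m). w U z (rm_received m U z))"
    using rec by (intro sum.cong refl) simp
  finally show ?thesis by (simp add: bit_error_def w_def)
qed

lemma bit_error_MAP_le:
  assumes "is_bit_MAP m r \<delta> x d"
  shows "bit_error m r \<delta> x d \<le> bit_error m r \<delta> x d'"
  unfolding bit_error_eq_sum_joint
proof (rule sum_mono)
  fix y assume "y \<in> Pow (rm_points m)"
  hence "rm_joint m r \<delta> x (\<not> d y) y \<le> rm_joint m r \<delta> x (d y) y"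
    using assms by (simp add: is_bit_MAP_def)
  thus "rm_joint m r \<delta> x (\<not> d y) y \<le> rm_joint m r \<delta> x (\<not> d' y) y"
    by (cases "d' y = d y") auto
qed

text \<open>The sign rule under codewords moves every error event to the zero codeword. A tie
  \<open>G z = 0\<close> is an error only when the sent bit is 1, but it is counted in both
  cases.\<close>

lemma bit_error_sign_decoder_le:
  assumes x: "x \<in> rm_points m" and \<delta>: "0 \<le> \<delta>" "\<delta> \<le> 1"
    and flip: "\<And>c z. c \<in> rm_code m r \<Longrightarrow> G (sym_diff z c) = (if x \<in> c then - G z else G z)"
  shows "bit_error m r \<delta> x (\<lambda>y. G y < (0::real))
    \<le> (\<Sum>z\<in>Pow (rm_points m). bern \<delta> (rm_points m) z * of_bool (G z \<le> 0))"
proof -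
  define k where "k = real (card (rm_coeffs m r))"
  have k: "k > 0" by (simp add: k_def rm_coeffs_def card_Pow)
  let ?E = "\<Sum>z\<in>Pow (rm_points m). bern \<delta> (rm_points m) z * of_bool (G z \<le> 0)"
  have "bit_error m r \<delta> x (\<lambda>y. G y < 0) \<le> (\<Sum>U\<in>rm_coeffs m r. 1 / k * ?E)"
    unfolding bit_error_def sum_distrib_left
  proof (intro sum_mono)
    fix U z assume U: "U \<in> rm_coeffs m r" and z: "z \<in> Pow (rm_points m)"
    let ?c = "{p \<in> rm_points m. rm_eval U p}"
    have c: "?c \<in> rm_code m r" using U by (simp add: rm_code_def)
    have "rm_received m U z = sym_diff z ?c" using z by (auto simp: rm_received_def)
    hence G: "G (rm_received m U z) = (if rm_eval U x then - G z else G z)"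
      using flip[OF c, of z] x by simp
    have w: "rm_weight m r \<delta> U z = 1 / k * bern \<delta> (rm_points m) z"
      using z by (simp add: rm_weight_def bern_eq k_def)
    have "0 \<le> 1 / k * bern \<delta> (rm_points m) z" using k bern_nonneg[OF \<delta>, of "rm_points m" z] by simp
    thus "(if (G (rm_received m U z) < 0) \<noteq> rm_eval U x then rm_weight m r \<delta> U z else 0)
      \<le> 1 / k * (bern \<delta> (rm_points m) z * of_bool (G z \<le> 0))"
      unfolding G w by (cases "rm_eval U x"; cases "G z \<le> 0") auto
  qed
  also have "\<dots> = ?E" unfolding sum_constant k_def[symmetric] using k by simp
  finally show ?thesis .
qed

text \<open>A constant correlation \<open>\<beta>\<close> for the short code becomes an error
  exponential in the number \<open>m - m'\<close> of dropped variables, by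
  \<open>average_variance\<close> with \<open>p = 1 / 2 ^ (m - m')\<close>.\<close>

lemma bit_error_boosted:
  fixes m m' r :: nat
  assumes m': "m' \<le> m" and x: "x \<in> rm_points m" and \<delta>: "0 \<le> \<delta>" "\<delta> < 1/2"
    and \<beta>: "0 < \<beta>" "\<beta> \<le> ln 2 * (1 - binom_le m' r / 2 ^ m' - bin_entropy \<delta>)"
    and d: "is_bit_MAP m r \<delta> x d"
  shows "bit_error m r \<delta> x d \<le> 1 / 2 ^ (m - m') / \<beta>\<^sup>2"
proof -
  have \<delta>1: "\<delta> \<le> 1" using \<delta> by simp
  have A: "finite (rm_points m')" "rm_points m' \<noteq> {}" by (auto simp: rm_points_def)
  have C: "rm_code m' r \<subseteq> Pow (rm_points m')" "rm_code m' r \<noteq> {}"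
    using empty_in_rm_code[of m' r] by (auto simp: rm_code_def rm_points_def)
  obtain i g where i: "i \<in> rm_points m'" and g_bound: "\<And>z. \<bar>g z\<bar> \<le> (1::real)"
    and g_remove: "\<And>z. g (z - {i}) = g z"
    and g_flip: "\<And>c z. c \<in> rm_code m' r \<Longrightarrow> g (sym_diff z c) = (if i \<in> c then - g z else g z)"
    and mean: "ln 2 * (1 - log 2 (card (rm_code m' r)) / card (rm_points m') - bin_entropy \<delta>)
      \<le> (\<Sum>z\<in>Pow (rm_points m' - {i}). bern \<delta> (rm_points m' - {i}) z * g z)"
    by (rule weak_prediction[OF A C _ \<delta>]) (erule rm_code_sym_diff, assumption, rule that)
  \<comment> \<open>The base point is left out because every graph sends it to \<open>x\<close>, so
    collisions there are certain; \<open>g\<close> ignores it anyway.\<close>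
  define A0 where "A0 = rm_points m' - {i}"
  define \<mu> where "\<mu> = (\<Sum>z\<in>Pow A0. bern \<delta> A0 z * g z)"
  have "\<beta> \<le> ln 2 * (1 - log 2 (card (rm_code m' r)) / card (rm_points m') - bin_entropy \<delta>)"
  proof -
    have "log 2 (card (rm_code m' r)) / 2 ^ m' \<le> binom_le m' r / 2 ^ m'"
      by (intro divide_right_mono log_card_rm_code) simp
    hence "ln 2 * (1 - binom_le m' r / 2 ^ m' - bin_entropy \<delta>)
      \<le> ln 2 * (1 - log 2 (card (rm_code m' r)) / 2 ^ m' - bin_entropy \<delta>)"
      by (intro mult_left_mono) auto
    thus ?thesis using \<beta>(2) unfolding card_rm_points of_nat_power of_nat_numeral by linarith
  qed
  hence \<mu>: "\<beta> \<le> \<mu>" using mean by (simp add: \<mu>_def A0_def)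
  define F where "F = Pow ({..<m'} \<times> {m'..<m})"
  have F: "finite F" "F \<noteq> {}" by (auto simp: F_def)
  define e where "e = graph_map m m' i x"
  define G where "G y = (\<Sum>B\<in>F. g {u \<in> A0. e B u \<in> y}) / real (card F)" for y
  have variance: "(\<Sum>z\<in>Pow (rm_points m). bern \<delta> (rm_points m) z * (G z - \<mu>)\<^sup>2) \<le> 1 / 2 ^ (m - m')"
    unfolding G_def \<mu>_def
  proof (rule average_variance)
    show "real (card {(b, b'). (b, b') \<in> F \<times> F \<and> e b a = e b' a}) \<le> 1 / 2 ^ (m - m') * (real (card F))\<^sup>2"
      if "a \<in> A0" for a
      unfolding e_def F_def using that i by (intro graph_map_collisions) (auto simp: A0_def)
    show "a = a'" if "a \<in> A0" "a' \<in> A0" "e b a = e b' a'" for b b' a a'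
      using graph_map_eq_imp[OF m', of a a' i x b b'] that by (simp add: A0_def e_def)
    show "e b a \<in> rm_points m" for b a
      unfolding e_def by (rule graph_map_in_points)
  qed (use F \<delta>(1) \<delta>1 g_bound in \<open>simp_all add: A0_def\<close>)
  \<comment> \<open>A long codeword pulled back along a graph is a short codeword whose bit at
    \<open>i\<close> is the bit at \<open>x\<close>, so each summand inherits the sign rule of
    \<open>g\<close>.\<close>
  have G_flip: "G (sym_diff z c) = (if x \<in> c then - G z else G z)" if c: "c \<in> rm_code m r" for c z
  proof -
    have "g {u \<in> A0. e B u \<in> sym_diff z c} = (if x \<in> c then - 1 else 1) * g {u \<in> A0. e B u \<in> z}" for B
    proof -
      define pull where "pull y = {u \<in> rm_points m'. e B u \<in> y}" for y
      have g_pull: "g {u \<in> A0. e B u \<in> y} = g (pull y)" for y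
      proof -
        have "{u \<in> A0. e B u \<in> y} = pull y - {i}" by (auto simp: A0_def pull_def)
        thus ?thesis using g_remove by simp
      qed
      have "pull (sym_diff z c) = sym_diff (pull z) (pull c)" by (auto simp: pull_def)
      moreover have "pull c \<in> rm_code m' r"
        unfolding pull_def e_def using c i by (rule graph_map_pullback)
      moreover have "i \<in> pull c \<longleftrightarrow> x \<in> c" using i x by (simp add: pull_def e_def graph_map_base)
      ultimately show ?thesis unfolding g_pull using g_flip by simp
    qed
    thus ?thesis by (simp add: G_def sum_negf)
  qed
  have "bit_error m r \<delta> x d \<le> bit_error m r \<delta> x (\<lambda>y. G y < 0)"
    using d by (rule bit_error_MAP_le)
  also have "\<dots> \<le> (\<Sum>z\<in>Pow (rm_points m). bern \<delta> (rm_points m) z * of_bool (G z \<le> 0))"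
    using x \<delta>(1) \<delta>1 G_flip by (rule bit_error_sign_decoder_le)
  \<comment> \<open>Chebyshev: \<open>G z \<le> 0\<close> means a deviation of at least
    \<open>\<beta>\<close> from the mean \<open>\<mu>\<close>.\<close>
  also have "\<dots> \<le> (\<Sum>z\<in>Pow (rm_points m). bern \<delta> (rm_points m) z * ((G z - \<mu>)\<^sup>2 / \<beta>\<^sup>2))"
  proof (intro sum_mono mult_left_mono bern_nonneg \<delta>(1) \<delta>1)
    fix z
    have "\<beta>\<^sup>2 \<le> (\<mu> - G z)\<^sup>2" if "G z \<le> 0"
      using that \<mu> \<beta> by (intro power_mono) auto
    thus "of_bool (G z \<le> 0) \<le> (G z - \<mu>)\<^sup>2 / \<beta>\<^sup>2"
      using \<beta>(1) by (auto simp: power2_commute[of \<mu>])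
  qed
  also have "\<dots> = (\<Sum>z\<in>Pow (rm_points m). bern \<delta> (rm_points m) z * (G z - \<mu>)\<^sup>2) / \<beta>\<^sup>2"
    by (simp add: sum_divide_distrib)
  also have "\<dots> \<le> 1 / 2 ^ (m - m') / \<beta>\<^sup>2"
    using variance by (intro divide_right_mono) auto
  finally show ?thesis .
qed

section \<open>Binomial estimates and the rate of codes in fewer variables\<close>

lemma central_binomial_double: "(2 * Suc k choose Suc k) = 2 * (2 * k + 1 choose k)"
proof -
  have "(2 * k + 1 choose k) = (2 * k + 1 choose Suc k)"
    using binomial_symmetric[of k "2 * k + 1"] by simp
  moreover have "2 * Suc k = Suc (2 * k + 1)" by simp
  ultimately show ?thesis by (simp only: binomial_Suc_Suc)
qed

lemma central_binomial_Suc: "Suc k * (2 * Suc k choose Suc k) = 2 * (2 * k + 1) * (2 * k choose k)"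
proof -
  have "Suc k * (2 * k + 1 choose Suc k) = (2 * k + 1) * (2 * k choose k)"
    using Suc_times_binomial[of k "2 * k"] by (simp del: binomial_Suc_Suc)
  moreover have "(2 * k + 1 choose k) = (2 * k + 1 choose Suc k)"
    using binomial_symmetric[of k "2 * k + 1"] by simp
  ultimately show ?thesis unfolding central_binomial_double by (simp only: mult.left_commute mult.assoc)
qed

text \<open>Squaring avoids roots in the induction: by \<open>central_binomial_Suc\<close> the step
  comes down to \<open>(2 * k + 1) * (2 * k + 3) \<le> 4 * (Suc k)\<^sup>2\<close>.\<close>

lemma central_binomial_square_le: "(2 * k choose k)\<^sup>2 * (2 * k + 1) \<le> 4 ^ (2 * k)"
proof (induction k)
  case (Suc k)
  define b where "b = (2 * Suc k choose Suc k)"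
  have b: "Suc k * b = 2 * (2 * k + 1) * (2 * k choose k)"
    unfolding b_def by (rule central_binomial_Suc)
  have "(Suc k)\<^sup>2 * (b\<^sup>2 * (2 * Suc k + 1)) = (Suc k * b)\<^sup>2 * (2 * Suc k + 1)"
    by (simp only: power_mult_distrib mult.assoc)
  also have "\<dots> = 4 * ((2 * k + 1) * (2 * k + 3)) * ((2 * k choose k)\<^sup>2 * (2 * k + 1))"
    unfolding b by (simp add: power2_eq_square algebra_simps)
  also have "\<dots> \<le> 4 * (4 * (Suc k)\<^sup>2) * 4 ^ (2 * k)"
  proof (rule mult_le_mono[OF mult_le_mono2 Suc.IH])
    show "(2 * k + 1) * (2 * k + 3) \<le> 4 * (Suc k)\<^sup>2" by (simp add: power2_eq_square algebra_simps)
  qed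
  also have "\<dots> = (Suc k)\<^sup>2 * 4 ^ (2 * Suc k)" by simp
  finally show ?case unfolding b_def by (subst (asm) mult_le_cancel1) simp
qed simp

text \<open>The middle coefficient is the largest. For odd \<open>n\<close> it is half of the
  central one for \<open>n + 1\<close>, by \<open>central_binomial_double\<close>.\<close>

lemma binomial_square_le: "(n choose k)\<^sup>2 * (n + 1) \<le> 4 ^ n"
proof -
  have max: "(n choose k) \<le> (n choose (n div 2))" by (rule binomial_maximum)
  have "(n choose (n div 2))\<^sup>2 * (n + 1) \<le> 4 ^ n"
  proof (cases "even n")
    case True
    then obtain l where "n = 2 * l" by blast
    thus ?thesis using central_binomial_square_le[of l] by simp
  next
    case False
    then obtain l where n: "n = 2 * l + 1" by (auto elim: oddE)
    have "4 * ((n choose l)\<^sup>2 * (n + 2)) = (2 * Suc l choose Suc l)\<^sup>2 * (2 * Suc l + 1)"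
      unfolding central_binomial_double n by (simp only: power_mult_distrib) simp
    also have "\<dots> \<le> 4 ^ (2 * Suc l)" by (rule central_binomial_square_le)
    also have "\<dots> = 4 * 4 ^ n" by (simp add: n)
    finally have "(n choose l)\<^sup>2 * (n + 2) \<le> 4 ^ n" by simp
    moreover have "n div 2 = l" using n by simp
    ultimately show ?thesis by (simp add: algebra_simps)
  qed
  moreover have "(n choose k)\<^sup>2 * (n + 1) \<le> (n choose (n div 2))\<^sup>2 * (n + 1)"
    using max by (intro mult_right_mono power_mono) auto
  ultimately show ?thesis by linarith
qed

lemma binom_le_Suc: "2 * binom_le n r = binom_le (Suc n) r + (n choose r)"
  by (induction r) (simp_all add: binom_le_def)

text \<open>By \<open>binom_le_Suc\<close>, going from \<open>N + 1\<close> to \<open>N\<close>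
  variables raises the rate by \<open>(N choose r) / 2 ^ Suc N\<close>, at most
  \<open>1 / (2 * sqrt (N + 1))\<close>. The smallest \<open>N\<close>, namely \<open>n\<close>,
  gives the worst of these bounds.\<close>

lemma rm_rate_restrict:
  "binom_le n r / 2 ^ n \<le> binom_le (n + k) r / 2 ^ (n + k) + k / (2 * sqrt (n + 1))"
proof (induction k)
  case (Suc k)
  define N where "N = n + k"
  have "2 * real (binom_le N r) = real (binom_le (Suc N) r) + real (N choose r)"
    using binom_le_Suc[of N r] by (metis of_nat_add of_nat_mult of_nat_numeral)
  hence 1: "binom_le N r / 2 ^ N = binom_le (Suc N) r / 2 ^ Suc N + (N choose r) / 2 ^ Suc N"
    by (simp add: field_simps)
  have "real ((N choose r)\<^sup>2 * (N + 1)) \<le> real (4 ^ N)"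
    using binomial_square_le of_nat_le_iff by blast
  moreover have "((2::real) ^ N)\<^sup>2 = 4 ^ N"
    by (simp add: power2_eq_square flip: power_mult_distrib)
  ultimately have "(real (N choose r) * sqrt (N + 1))\<^sup>2 \<le> (2 ^ N)\<^sup>2"
    by (simp add: power_mult_distrib algebra_simps)
  hence "real (N choose r) * sqrt (N + 1) \<le> 2 ^ N"
    by (rule power2_le_imp_le) simp
  moreover have "sqrt (n + 1) \<le> sqrt (N + 1)" by (simp add: N_def)
  hence "real (N choose r) * sqrt (n + 1) \<le> real (N choose r) * sqrt (N + 1)"
    by (intro mult_left_mono) auto
  ultimately have "real (N choose r) * sqrt (n + 1) \<le> 2 ^ N" by linarith
  moreover have "sqrt (real n + 1) > 0" by simp
  ultimately have "(N choose r) / 2 ^ Suc N \<le> 1 / (2 * sqrt (n + 1))"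
    by (simp add: field_simps)
  thus ?case using Suc.IH 1 by (simp add: N_def add_divide_distrib add_ac)
qed simp

theorem theorem8p2:
  fixes \<delta> :: real and r :: "nat \<Rightarrow> nat"
  assumes "0 \<le> \<delta>" and "\<delta> < 1/2"
    and "\<forall>m\<ge>1. r m \<le> m"
    and "limsup (\<lambda>m. ereal (real (binom_le m (r m)) / 2 ^ m)) < ereal (1 - bin_entropy \<delta>)"
  shows "\<exists>c>0. \<exists>m0. \<forall>m\<ge>m0. \<forall>x\<in>rm_points m. \<forall>d.
           is_bit_MAP m (r m) \<delta> x d \<longrightarrow> bit_error m (r m) \<delta> x d \<le> 2 powr (- c * sqrt m)"
proof -
  \<comment> \<open>A rate strictly between the limit superior and the capacity leaves a gap
    \<open>\<epsilon>\<close> valid for all large \<open>m\<close>.\<close>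
  obtain \<rho> where \<rho>: "limsup (\<lambda>m. ereal (real (binom_le m (r m)) / 2 ^ m)) < ereal \<rho>"
    "ereal \<rho> < ereal (1 - bin_entropy \<delta>)"
    using ereal_dense2[OF assms(4)] by blast
  have "\<forall>\<^sub>F m in sequentially. ereal (real (binom_le m (r m)) / 2 ^ m) < ereal \<rho>"
    using \<rho>(1) by (rule Limsup_lessD)
  then obtain m1 where m1: "\<And>m. m \<ge> m1 \<Longrightarrow> real (binom_le m (r m)) / 2 ^ m < \<rho>"
    unfolding eventually_sequentially by auto
  define \<epsilon> where "\<epsilon> = 1 - bin_entropy \<delta> - \<rho>"
  have \<epsilon>: "\<epsilon> > 0" using \<rho>(2) by (simp add: \<epsilon>_def)
  \<comment> \<open>About \<open>a * sqrt m\<close> variables get dropped. The bound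
    \<open>\<epsilon> / 2\<close> lets this use up at most half of the gap, and the bound 1 keeps at
    least half of the variables.\<close>
  define a where "a = min 1 (\<epsilon> / 2)"
  have a: "0 < a" "a \<le> 1" "a \<le> \<epsilon> / 2" using \<epsilon> by (auto simp: a_def)
  define \<beta> where "\<beta> = ln 2 * (\<epsilon> / 2)"
  have \<beta>: "\<beta> > 0" using \<epsilon> by (simp add: \<beta>_def)
  \<comment> \<open>Chosen so that for \<open>sqrt m \<ge> L\<close> half of the exponent
    \<open>a * sqrt m\<close> absorbs both the factor \<open>1 / \<beta>\<^sup>2\<close> and the
    loss of 1 from rounding \<open>k\<close> down.\<close>
  define L where "L = 2 / a * (1 - log 2 (\<beta>\<^sup>2))"
  define m0 where "m0 = max (max m1 4) (nat \<lceil>L\<^sup>2\<rceil>)"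
  have "bit_error m (r m) \<delta> x d \<le> 2 powr (- (a / 2) * sqrt m)"
    if m: "m \<ge> m0" and x: "x \<in> rm_points m" and d: "is_bit_MAP m (r m) \<delta> x d" for m x d
  proof -
    have m4: "real m \<ge> 4" and L: "L \<le> sqrt m"
    proof -
      show "real m \<ge> 4" using m by (simp add: m0_def)
      have "L\<^sup>2 \<le> real m" using m unfolding m0_def by linarith
      thus "L \<le> sqrt m" by (rule real_le_rsqrt)
    qed
    define k where "k = nat \<lfloor>a * sqrt m\<rfloor>"
    have k: "real k \<le> a * sqrt m" "a * sqrt m \<le> real k + 1"
      using a by (auto simp: k_def intro: order.trans[OF _ real_of_int_floor_add_one_ge])
    have "2 * sqrt m \<le> m"
    proof -
      have "2 \<le> sqrt m" using m4 by (intro real_le_rsqrt) simp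
      hence "2 * sqrt m \<le> sqrt m * sqrt m" by (intro mult_right_mono) auto
      thus ?thesis by simp
    qed
    moreover have "a * sqrt m \<le> 1 * sqrt m" using a by (intro mult_right_mono) auto
    ultimately have "2 * real k \<le> m" using k by linarith
    hence km: "2 * k \<le> m" by linarith
    define m' where "m' = m - k"
    have m': "m' \<le> m" "m' + k = m" "m - m' = k" using km by (auto simp: m'_def)
    \<comment> \<open>Generous, since \<open>2 * k \<le> m\<close> gives even
      \<open>m \<le> 2 * m'\<close>; the root of 4 matches the 2 in the denominator of
      \<open>rm_rate_restrict\<close>.\<close>
    have "m \<le> 4 * (m' + 1)" using km m'(2) by presburger
    hence "real m \<le> real (4 * (m' + 1))" by (rule of_nat_mono)
    hence "real m \<le> 4 * (real m' + 1)" by simp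
    hence "sqrt m \<le> sqrt (4 * (real m' + 1))" by (rule real_sqrt_le_mono)
    also have "\<dots> = 2 * sqrt (m' + 1)" by (simp only: real_sqrt_mult real_sqrt_four of_nat_add of_nat_1)
    finally have "sqrt m \<le> 2 * sqrt (m' + 1)" .
    hence "a * sqrt m \<le> a * (2 * sqrt (m' + 1))" using a by (intro mult_left_mono) auto
    hence "real k \<le> a * (2 * sqrt (m' + 1))" using k by linarith
    hence "k / (2 * sqrt (m' + 1)) \<le> a" by (simp add: divide_le_eq add_pos_nonneg)
    moreover have "binom_le m' (r m) / 2 ^ m' \<le> binom_le m (r m) / 2 ^ m + k / (2 * sqrt (m' + 1))"
      using rm_rate_restrict[of m' "r m" k] unfolding m'(2) by (simp add: add.commute)
    moreover have "real (binom_le m (r m)) / 2 ^ m < \<rho>" using m by (intro m1) (simp add: m0_def)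
    ultimately have "\<epsilon> / 2 \<le> 1 - binom_le m' (r m) / 2 ^ m' - bin_entropy \<delta>"
      using a(3) by (simp add: \<epsilon>_def)
    hence "\<beta> \<le> ln 2 * (1 - binom_le m' (r m) / 2 ^ m' - bin_entropy \<delta>)"
      unfolding \<beta>_def by (intro mult_left_mono) auto
    hence "bit_error m (r m) \<delta> x d \<le> 1 / 2 ^ k / \<beta>\<^sup>2"
      using bit_error_boosted[OF m'(1) x assms(1,2) \<beta> _ d] m'(3) by simp
    also have "1 / 2 ^ k = 2 powr (- real k)" by (simp add: powr_minus powr_realpow divide_inverse)
    also have "\<beta>\<^sup>2 = 2 powr (log 2 (\<beta>\<^sup>2))" using \<beta> by simp
    also have "2 powr (- real k) / 2 powr (log 2 (\<beta>\<^sup>2)) = 2 powr (- real k - log 2 (\<beta>\<^sup>2))"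
      by (simp add: powr_diff)
    also have "\<dots> \<le> 2 powr (- (a / 2) * sqrt m)"
    proof (rule powr_mono)
      have "1 - log 2 (\<beta>\<^sup>2) = a / 2 * L" using a by (simp add: L_def)
      also have "\<dots> \<le> a / 2 * sqrt m" using L a by (intro mult_left_mono) auto
      finally show "- real k - log 2 (\<beta>\<^sup>2) \<le> - (a / 2) * sqrt m" using k(2) by simp
    qed simp
    finally show ?thesis .
  qed
  thus ?thesis using a(1) by (intro exI[of _ "a / 2"] conjI exI[of _ m0]) auto
qed

end
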